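(* Let $\zeta$ be a transcendental real number. Then $\zeta$ is a $U$-number if and only if $\lim_{n\to\infty}\widehat{w}^{\ast}_n(\zeta)<\infty$. More precisely, if $\zeta$ is a $U_m$-number, then $\widehat{w}^{\ast}_n(\zeta)\in[m-1,m]$ for all sufficiently large $n$. Moreover, $\zeta$ is a $T$-number if and only if \[\lim_{n\to\infty}\widehat{w}^{\ast}_n(\zeta)=\infty\quad\text{and}\quad\liminf_{n\to\infty}\frac{\widehat{w}^{\ast}_n(\zeta)}{n}=0.\] Finally, $\zeta$ is an $S$-number if and only if there exists a constant $\delta>0$ such that $\widehat{w}^{\ast}_n(\zeta)\ge\delta n$ for all $n\ge1$.
   Context: For an integer polynomial $P$, $H(P)$ is the maximum modulus of its coefficients; for a real algebraic number $\alpha$, $H(\alpha)=H(P)$ where $P$ is the minimal polynomial of $\alpha$ with coprime integer coefficients. $\widehat{w}^{\ast}_n(\zeta)$ is the supremum of $w^\ast$ such that the system $H(\alpha)\le X$, $|\zeta-\alpha|\le H(\alpha)^{-1}X^{-w^\ast}$ has a real algebraic solution $\alpha$ of degree at most $n$ for all sufficiently large $X$ (this sequence is non-decreasing in $n$). $w_n(\zeta)$ is the supremum of $w$ such that $0<|P(\zeta)|\le H(P)^{-w}$ has infinitely many solutions $P\in\mathbb{Z}[T]$ of degree at most $n$. Mahler's classification: $\zeta$ is a $U_m$-number if $w_m(\zeta)=\infty$ with $m$ minimal; a $U$-number is a $U_m$-number for some $m$; a $T$-number has all $w_n(\zeta)<\infty$ but $\limsup w_n(\zeta)/n=\infty$;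 an $S$-number has $\limsup w_n(\zeta)/n<\infty$. *)

theory Defs
  imports "HOL-Analysis.Analysis" "HOL-Computational_Algebra.Polynomial"
begin

definition poly_height :: "int poly \<Rightarrow> int" where
  "poly_height P = Max ((\<lambda>i. \<bar>coeff P i\<bar>) ` {..degree P})"

abbreviation int_poly_eval :: "int poly \<Rightarrow> real \<Rightarrow> real" where
  "int_poly_eval P x \<equiv> poly (map_poly of_int P) x"

(* "content P = 1" is coprimality of the coefficients (and excludes P = 0);
   the sign of the leading coefficient is fixed to make P unique. *)
definition is_int_min_poly :: "int poly \<Rightarrow> real \<Rightarrow> bool" where
  "is_int_min_poly P \<alpha> \<longleftrightarrow>
     content P = 1 \<and> lead_coeff P > 0 \<and> int_poly_eval P \<alpha> = 0 \<and>
     (\<forall>Q. Q \<noteq> 0 \<longrightarrow> int_poly_eval Q \<alpha> = 0 \<longrightarrow> degree P \<le> degree Q)"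

definition int_min_poly :: "real \<Rightarrow> int poly" where
  "int_min_poly \<alpha> = (THE P. is_int_min_poly P \<alpha>)"

lemma is_int_min_poly_unique:
  assumes P: "is_int_min_poly P \<alpha>" and Q: "is_int_min_poly Q \<alpha>"
  shows "P = Q"
proof -
  have [simp]: "P \<noteq> 0" "Q \<noteq> 0"
    using P Q by (auto simp: is_int_min_poly_def)
  have deg: "degree P = degree Q"
    using P Q by (intro antisym) (auto simp: is_int_min_poly_def)
  define R where "R = smult (lead_coeff Q) P - smult (lead_coeff P) Q"
  have "map_poly real_of_int R =
      smult (of_int (lead_coeff Q)) (map_poly of_int P) -
      smult (of_int (lead_coeff P)) (map_poly of_int Q)"
    by (rule poly_eqI) (simp add: R_def coeff_map_poly)
  hence eval: "int_poly_eval R \<alpha> = 0"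
    using P Q by (simp add: is_int_min_poly_def)
  have "R = 0"
  proof (rule ccontr)
    assume "R \<noteq> 0"
    have "degree R \<le> degree P"
      unfolding R_def using deg by (intro degree_diff_le) auto
    moreover have "coeff R (degree P) = 0"
      by (simp add: R_def deg)
    ultimately have "degree R < degree P \<or> degree P = 0"
      using \<open>R \<noteq> 0\<close> by (metis leading_coeff_0_iff le_neq_implies_less)
    thus False
      using eval P \<open>R \<noteq> 0\<close> \<open>coeff R (degree P) = 0\<close> \<open>degree R \<le> degree P\<close>
      by (metis is_int_min_poly_def leading_coeff_0_iff le_antisym)
  qed
  hence eq: "smult (lead_coeff Q) P = smult (lead_coeff P) Q"
    by (simp add: R_def)
  hence "content (smult (lead_coeff Q) P) = content (smult (lead_coeff P) Q)"
    by simp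
  hence "lead_coeff Q = lead_coeff P"
    using P Q by (simp add: is_int_min_poly_def)
  thus ?thesis
    using eq by (metis \<open>Q \<noteq> 0\<close> leading_coeff_0_iff smult_cancel)
qed

lemma is_int_min_poly_int_min_poly:
  assumes "algebraic \<alpha>"
  shows "is_int_min_poly (int_min_poly \<alpha>) \<alpha>"
proof -
  define root where "root = (\<lambda>Q :: int poly. Q \<noteq> 0 \<and> int_poly_eval Q \<alpha> = 0)"
  obtain p :: "real poly" where p: "\<And>i. coeff p i \<in> \<int>" "p \<noteq> 0" "poly p \<alpha> = 0"
    using assms unfolding algebraic_def by blast
  define p' where "p' = map_poly floor p"
  have p': "map_poly of_int p' = p"
  proof (rule poly_eqI)
    fix i
    show "coeff (map_poly of_int p') i = coeff p i"
      using p(1)[of i] by (auto simp: p'_def coeff_map_poly elim!: Ints_cases)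
  qed
  hence "root p'"
    using p by (auto simp: root_def)
  then obtain Q where Q: "root Q" "\<And>Q'. root Q' \<Longrightarrow> degree Q \<le> degree Q'"
    using ex_has_least_nat[of root p' degree] by blast
  define c where "c = sgn (lead_coeff Q) * content Q"
  define P where "P = smult (sgn (lead_coeff Q)) (primitive_part Q)"
  have Q0: "Q \<noteq> 0"
    using Q(1) by (simp add: root_def)
  have sgn_sq: "sgn (lead_coeff Q) * sgn (lead_coeff Q) = 1"
    using Q0 by (simp add: sgn_if)
  have QP: "Q = smult c P"
  proof -
    have "smult c P = smult (sgn (lead_coeff Q) * sgn (lead_coeff Q))
            (smult (content Q) (primitive_part Q))"
      by (simp add: c_def P_def mult_ac del: content_times_primitive_part)
    thus ?thesis
      by (simp only: sgn_sq content_times_primitive_part smult_1_left)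
  qed
  have c0: "c \<noteq> 0"
    using QP Q0 by auto
  have deg: "degree P = degree Q"
    using QP c0 by simp
  have "content P = 1"
    using Q0 by (simp add: P_def sgn_if)
  moreover have "lead_coeff P > 0"
  proof -
    have lc: "lead_coeff Q = c * lead_coeff P"
      by (subst QP) (simp add: deg)
    have "normalize (content Q) = content Q"
      by (rule normalize_content)
    hence "content Q \<ge> 0"
      by (simp add: abs_ge_zero)
    moreover have "content Q \<noteq> 0"
      using Q0 by simp
    ultimately have "content Q > 0"
      by linarith
    hence "sgn (lead_coeff Q) = sgn (lead_coeff Q) * sgn (lead_coeff P)"
      using arg_cong[OF lc, of sgn] by (simp add: c_def sgn_mult)
    moreover have "sgn (lead_coeff Q) \<noteq> 0"
      using Q0 by (simp add: sgn_if)
    ultimately have "sgn (lead_coeff P) = 1"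
      by simp
    thus ?thesis
      by (simp add: sgn_1_pos)
  qed
  moreover have "int_poly_eval P \<alpha> = 0"
  proof -
    have "map_poly real_of_int Q = smult (of_int c) (map_poly of_int P)"
      by (rule poly_eqI) (simp add: QP coeff_map_poly)
    thus ?thesis
      using Q(1) c0 by (simp add: root_def)
  qed
  ultimately have "is_int_min_poly P \<alpha>"
    using Q(2) deg by (auto simp: is_int_min_poly_def root_def)
  thus ?thesis
    unfolding int_min_poly_def by (metis is_int_min_poly_unique theI)
qed

definition alg_degree :: "real \<Rightarrow> nat" where
  "alg_degree \<alpha> = degree (int_min_poly \<alpha>)"

definition alg_height :: "real \<Rightarrow> int" where
  "alg_height \<alpha> = poly_height (int_min_poly \<alpha>)"

definition w_exponent :: "nat \<Rightarrow> real \<Rightarrow> ereal" where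
  "w_exponent n \<zeta> = (SUP w \<in> {w :: real. infinite {P :: int poly. degree P \<le> n \<and>
       0 < \<bar>int_poly_eval P \<zeta>\<bar> \<and>
       \<bar>int_poly_eval P \<zeta>\<bar> \<le> real_of_int (poly_height P) powr (- w)}}. ereal w)"

definition w_hat_star :: "nat \<Rightarrow> real \<Rightarrow> ereal" where
  "w_hat_star n \<zeta> = (SUP w \<in> {w :: real. \<forall>\<^sub>F X :: real in at_top.
       \<exists>\<alpha> :: real. algebraic \<alpha> \<and> alg_degree \<alpha> \<le> n \<and>
         real_of_int (alg_height \<alpha>) \<le> X \<and>
         \<bar>\<zeta> - \<alpha>\<bar> \<le> inverse (real_of_int (alg_height \<alpha>)) * X powr (- w)}. ereal w)"

definition Um_number :: "nat \<Rightarrow> real \<Rightarrow> bool" where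
  "Um_number m \<zeta> \<longleftrightarrow> m \<ge> 1 \<and> w_exponent m \<zeta> = \<infinity> \<and>
     (\<forall>k. 1 \<le> k \<longrightarrow> k < m \<longrightarrow> w_exponent k \<zeta> < \<infinity>)"

definition U_number :: "real \<Rightarrow> bool" where
  "U_number \<zeta> \<longleftrightarrow> (\<exists>m. Um_number m \<zeta>)"

definition T_number :: "real \<Rightarrow> bool" where
  "T_number \<zeta> \<longleftrightarrow> (\<forall>n\<ge>1. w_exponent n \<zeta> < \<infinity>) \<and>
     limsup (\<lambda>n. w_exponent n \<zeta> / ereal (real n)) = \<infinity>"

definition S_number :: "real \<Rightarrow> bool" where
  "S_number \<zeta> \<longleftrightarrow> limsup (\<lambda>n. w_exponent n \<zeta> / ereal (real n)) < \<infinity>"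

end

theory Submission
  imports Defs "Berlekamp_Zassenhaus.Factor_Bound" "Subresultants.Subresultant_Gcd"
begin

text \<open>
  Lower bounds for \<open>w_hat_star\<close>: suppose \<open>w_e < K e\<close> for \<open>1 \<le> e \<le> m\<close>. Dirichlet's theorem gives an
  integer polynomial \<open>P\<close> of degree at most \<open>m\<close> and height at most \<open>Y\<close> with \<open>P(\<zeta>)\<close> of size
  \<open>Y\<close> to the power \<open>- m\<close>. To each irreducible factor \<open>E\<close> of \<open>P\<close> belongs an integer polynomial \<open>B\<close>
  coprime to \<open>E\<close>, of degree at most \<open>K deg E\<close>, which up to constants is no larger than \<open>E\<close> in height
  and at \<open>\<zeta>\<close>. Replacing factors \<open>E\<close> by \<open>B\<close> in all possible ways produces polynomials as good as \<open>P\<close>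
  whose multiples span all polynomials of degree at most \<open>n = (K + 1) m\<close>. Hence every real polynomial,
  in particular a large multiple of \<open>T - \<zeta>\<close>, is well approximated by an integer polynomial \<open>R\<close>, and
  \<open>R\<close> has a real root very close to \<open>\<zeta>\<close>. Since the height of a divisor of \<open>R\<close> is bounded in terms
  of that of \<open>R\<close>, irreducibility of \<open>R\<close> plays no role, and \<open>w_hat_star n \<ge> m\<close>.

  Upper bounds: if \<open>Q\<close> of degree at most \<open>m\<close> is extremely small at \<open>\<zeta>\<close>, then at a suitable scale \<open>X\<close>
  every algebraic number of height at most \<open>X\<close> is either a root of \<open>Q\<close>, or far from \<open>\<zeta>\<close> because the
  resultant of its minimal polynomial with \<open>Q\<close> is a nonzero integer. This yields
  \<open>w_hat_star n \<le> m + (n + 1) m / (w_m - n)\<close>.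
\<close>

hide_const (open) up_ring.coeff up_ring.monom Module.smult

subsection \<open>Heights of integer polynomials\<close>

lemma abs_coeff_le_height: "\<bar>coeff P i\<bar> \<le> poly_height P"
proof (cases "i \<le> degree P")
  case True
  thus ?thesis unfolding poly_height_def by (intro Max_ge) auto
next
  case False
  have "0 \<le> \<bar>coeff P 0\<bar>" by simp
  also have "\<dots> \<le> poly_height P" unfolding poly_height_def by (intro Max_ge) auto
  finally show ?thesis using False by (simp add: coeff_eq_0)
qed

lemma height_attained: "\<exists>i. poly_height P = \<bar>coeff P i\<bar>"
proof -
  have "poly_height P \<in> (\<lambda>i. \<bar>coeff P i\<bar>) ` {..degree P}"
    unfolding poly_height_def by (rule Max_in) auto
  thus ?thesis by auto
qed

lemma height_leI: "(\<And>i. \<bar>real_of_int (coeff P i)\<bar> \<le> h) \<Longrightarrow> real_of_int (poly_height P) \<le> h"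
  using height_attained[of P] by (metis of_int_abs)

lemma abs_coeff_le_height_real: "\<bar>real_of_int (coeff P i)\<bar> \<le> real_of_int (poly_height P)"
  using abs_coeff_le_height[of P i] by linarith

lemma height_ge_1: "P \<noteq> 0 \<Longrightarrow> poly_height P \<ge> 1"
  using abs_coeff_le_height[of P "degree P"] by (smt (verit) leading_coeff_0_iff)

lemma height_ge_1_real: "P \<noteq> 0 \<Longrightarrow> real_of_int (poly_height P) \<ge> 1"
  using height_ge_1 by simp

lemma finite_bounded_height: "finite {P :: int poly. degree P \<le> n \<and> poly_height P \<le> h}"
proof -
  let ?S = "{P :: int poly. degree P \<le> n \<and> poly_height P \<le> h}"
  have "inj_on coeffs ?S" by (auto intro: inj_onI simp: coeffs_eq_iff)
  moreover have "coeffs ` ?S \<subseteq> {xs. set xs \<subseteq> {-h..h} \<and> length xs \<le> Suc n}"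
  proof safe
    fix P :: "int poly" and x assume P: "degree P \<le> n" "poly_height P \<le> h" "x \<in> set (coeffs P)"
    hence "x \<in> range (coeff P)" by (simp add: range_coeff)
    then obtain i where "x = coeff P i" by blast
    thus "x \<in> {-h..h}" using abs_coeff_le_height[of P i] P(2) by auto
  next
    fix P :: "int poly" assume P: "degree P \<le> n"
    thus "length (coeffs P) \<le> Suc n"
      by (cases "P = 0") (auto simp: length_coeffs_degree)
  qed
  moreover have "finite {xs. set xs \<subseteq> {-h..h} \<and> length xs \<le> Suc n}"
    by (rule finite_lists_length_le) simp
  ultimately show ?thesis by (meson finite_imageD finite_subset)
qed

section \<open>Values and variation of real polynomials\<close>

lemma poly_eq_sum_le: "degree p \<le> n \<Longrightarrow> poly p x = (\<Sum>i\<le>n. coeff p i * x ^ i)"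
  for p :: "'a :: comm_semiring_1 poly"
  unfolding poly_altdef by (intro sum.mono_neutral_left) (auto simp: coeff_eq_0)

lemma abs_poly_le:
  fixes F :: "real poly"
  assumes "degree F \<le> n" "\<And>i. \<bar>coeff F i\<bar> \<le> h"
  shows "\<bar>poly F x\<bar> \<le> h * (\<Sum>i\<le>n. \<bar>x\<bar> ^ i)"
proof -
  have "\<bar>poly F x\<bar> \<le> (\<Sum>i\<le>n. \<bar>coeff F i * x ^ i\<bar>)"
    unfolding poly_eq_sum_le[OF assms(1)] by (rule sum_abs)
  also have "\<dots> \<le> (\<Sum>i\<le>n. h * \<bar>x\<bar> ^ i)"
    by (intro sum_mono) (simp add: abs_mult power_abs mult_right_mono assms)
  finally show ?thesis by (simp add: sum_distrib_left)
qed

text \<open>Bounds the derivative, on the interval of radius 1 about \<open>x\<close>, of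
  polynomials of degree at most \<open>n\<close> with coefficients at most 1 in absolute value. The
  truncated exponent at \<open>i = 0\<close> is harmless because of the factor
  \<open>i\<close>.\<close>

definition lipschitz_const :: "nat \<Rightarrow> real \<Rightarrow> real" where
  "lipschitz_const n x = (\<Sum>i\<le>n. real i * (\<bar>x\<bar> + 1) ^ (i - 1))"

lemma lipschitz_const_nonneg: "0 \<le> lipschitz_const n x"
  unfolding lipschitz_const_def by (intro sum_nonneg) auto

lemma abs_power_diff_le:
  fixes x t :: real
  assumes "\<bar>x\<bar> \<le> r" "\<bar>t\<bar> \<le> r"
  shows "\<bar>t ^ i - x ^ i\<bar> \<le> real i * r ^ (i - 1) * \<bar>t - x\<bar>"
proof -
  have r: "0 \<le> r" using assms by linarith
  have "\<bar>\<Sum>p<i. t ^ p * x ^ (i - Suc p)\<bar> \<le> (\<Sum>p<i. r ^ (i - 1))"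
  proof (rule order_trans[OF sum_abs], rule sum_mono)
    fix p assume "p \<in> {..<i}"
    hence e: "i - 1 = p + (i - Suc p)" by auto
    have "\<bar>t ^ p * x ^ (i - Suc p)\<bar> = \<bar>t\<bar> ^ p * \<bar>x\<bar> ^ (i - Suc p)"
      by (simp add: abs_mult power_abs)
    also have "\<dots> \<le> r ^ p * r ^ (i - Suc p)"
      using assms r by (intro mult_mono power_mono) auto
    finally show "\<bar>t ^ p * x ^ (i - Suc p)\<bar> \<le> r ^ (i - 1)"
      unfolding e power_add .
  qed
  hence "\<bar>t - x\<bar> * \<bar>\<Sum>p<i. t ^ p * x ^ (i - Suc p)\<bar> \<le> \<bar>t - x\<bar> * (real i * r ^ (i - 1))"
    by (intro mult_left_mono) auto
  moreover have "t ^ i - x ^ i = (t - x) * (\<Sum>p<i. t ^ p * x ^ (i - Suc p))"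
    using diff_power_eq_sum[of t "i - 1" x] by (cases i) (auto simp: mult.commute)
  ultimately show ?thesis by (simp add: abs_mult mult_ac)
qed

lemma poly_lipschitz:
  fixes F :: "real poly"
  assumes "degree F \<le> n" "\<And>i. \<bar>coeff F i\<bar> \<le> h" "\<bar>t - x\<bar> \<le> 1"
  shows "\<bar>poly F t - poly F x\<bar> \<le> h * lipschitz_const n x * \<bar>t - x\<bar>"
proof -
  have "\<bar>poly F t - poly F x\<bar> = \<bar>\<Sum>i\<le>n. coeff F i * (t ^ i - x ^ i)\<bar>"
    unfolding poly_eq_sum_le[OF assms(1)] by (simp add: sum_subtractf right_diff_distrib)
  also have "\<dots> \<le> (\<Sum>i\<le>n. \<bar>coeff F i * (t ^ i - x ^ i)\<bar>)" by (rule sum_abs)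
  also have "\<dots> \<le> (\<Sum>i\<le>n. h * (real i * (\<bar>x\<bar> + 1) ^ (i - 1) * \<bar>t - x\<bar>))"
  proof (rule sum_mono)
    fix i
    have "\<bar>t ^ i - x ^ i\<bar> \<le> real i * (\<bar>x\<bar> + 1) ^ (i - 1) * \<bar>t - x\<bar>"
      using assms(3) by (intro abs_power_diff_le) linarith+
    moreover have "0 \<le> h" using assms(2)[of 0] by linarith
    ultimately show "\<bar>coeff F i * (t ^ i - x ^ i)\<bar> \<le> h * (real i * (\<bar>x\<bar> + 1) ^ (i - 1) * \<bar>t - x\<bar>)"
      unfolding abs_mult using assms(2) by (intro mult_mono) auto
  qed
  also have "\<dots> = h * lipschitz_const n x * \<bar>t - x\<bar>"
    by (simp add: lipschitz_const_def sum_distrib_left sum_distrib_right mult.assoc)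
  finally show ?thesis .
qed

text \<open>At most \<open>n + 1\<close> terms of the convolution are nonzero. The constant thus
  depends on the degree of one factor alone, in the application an irreducible factor or its
  companion.\<close>

lemma abs_coeff_mult_le:
  fixes F G :: "real poly"
  assumes "degree F \<le> n" "\<And>i. \<bar>coeff F i\<bar> \<le> a" "\<And>i. \<bar>coeff G i\<bar> \<le> b"
  shows "\<bar>coeff (F * G) i\<bar> \<le> real (n + 1) * (a * b)"
proof -
  have ab: "0 \<le> a" "0 \<le> b" using assms(2,3)[of 0] by linarith+
  have "coeff (F * G) i = (\<Sum>k\<in>{..i} \<inter> {..n}. coeff F k * coeff G (i - k))"
    unfolding coeff_mult using assms(1)
    by (intro sum.mono_neutral_right) (auto simp: coeff_eq_0)
  also have "\<bar>\<dots>\<bar> \<le> (\<Sum>k\<in>{..i} \<inter> {..n}. a * b)"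
    by (rule order_trans[OF sum_abs], rule sum_mono) (auto intro!: mult_mono simp: abs_mult assms ab)
  also have "\<dots> = real (card ({..i} \<inter> {..n})) * (a * b)" by simp
  also have "\<dots> \<le> real (card {..n}) * (a * b)"
    using ab by (intro mult_right_mono of_nat_mono card_mono) auto
  finally show ?thesis by simp
qed

section \<open>Mahler measure and Gelfond's inequality\<close>

text \<open>Landau's inequality bounds the Mahler measure by the Euclidean norm of the coefficients,
  which is at most \<open>sqrt (n + 1)\<close> times the height; \<open>n + 1\<close> is a cruder
  factor without a root.\<close>

lemma mahler_measure_le_height:
  assumes "degree P \<le> n"
  shows "mahler_measure P \<le> real (n + 1) * real_of_int (poly_height P)"
proof (cases "P = 0")
  case False
  let ?h = "real_of_int (poly_height P)"
  let ?c = "map_poly complex_of_int P"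
  have h: "1 \<le> ?h" using height_ge_1[OF False] by simp
  have "norm2 ?c \<le> (\<Sum>a\<leftarrow>coeffs ?c. ?h ^ 2)"
  proof (rule sum_list_mono)
    fix a assume "a \<in> set (coeffs ?c)"
    hence "a \<in> range (coeff ?c)" using range_coeff[of ?c] by blast
    then obtain i where "a = coeff ?c i" by blast
    hence "cmod a = \<bar>real_of_int (coeff P i)\<bar>" by (simp add: coeff_map_poly)
    thus "(cmod a)\<^sup>2 \<le> ?h\<^sup>2" using abs_coeff_le_height_real[of P i] by (intro power_mono) auto
  qed
  also have "\<dots> = real (length (coeffs ?c)) * ?h ^ 2"
    by (simp add: sum_list_triv)
  also have "length (coeffs ?c) \<le> n + 1"
    using assms False by (cases "?c = 0") (auto simp: length_coeffs_degree)
  hence "real (length (coeffs ?c)) * ?h ^ 2 \<le> (real (n+1) * ?h) ^ 2"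
  proof -
    assume "length (coeffs ?c) \<le> n + 1"
    hence "real (length (coeffs ?c)) \<le> real (n + 1)" by (rule of_nat_mono)
    also have "\<dots> \<le> real (n + 1) * real (n + 1)"
      using mult_left_mono[of 1 "real (n + 1)" "real (n + 1)"] by simp
    finally have "real (length (coeffs ?c)) \<le> (real (n + 1))\<^sup>2" by (simp add: power2_eq_square)
    thus ?thesis unfolding power_mult_distrib by (intro mult_right_mono) auto
  qed
  finally have "l2norm_complex ?c \<le> real (n+1) * ?h"
    using h by (intro real_le_lsqrt) auto
  thus ?thesis unfolding mahler_measure_def using Landau_inequality[of ?c] by linarith
qed (simp add: mahler_measure_def poly_height_def)

lemma height_le_mahler_measure:
  assumes "degree P \<le> n"
  shows "real_of_int (poly_height P) \<le> 2 ^ n * mahler_measure P"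
proof (rule height_leI)
  fix i
  have "real (degree P choose i) \<le> 2 ^ degree P"
    using binomial_le_pow2[of "degree P" i] by (metis numeral_power_eq_of_nat_cancel_iff of_nat_le_iff)
  also have "\<dots> \<le> 2 ^ n" using assms by (simp add: power_increasing)
  finally have "real (degree P choose i) * mahler_measure P \<le> 2 ^ n * mahler_measure P"
    by (intro mult_right_mono mahler_measure_ge_0)
  thus "\<bar>real_of_int (coeff P i)\<bar> \<le> 2 ^ n * mahler_measure P"
    using Mignotte_bound[of P i] by simp
qed

text \<open>A factor \<open>2 ^ n\<close> for each of two polynomials, by Mignotte's bound, and
  \<open>n + 1\<close> for their product, by Landau's inequality.\<close>

definition gelfond_const :: "nat \<Rightarrow> real" where
  "gelfond_const n = 4 ^ n * real (n + 1)"

lemma gelfond_const_ge_1: "gelfond_const n \<ge> 1"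
  unfolding gelfond_const_def using mult_mono[of 1 "4^n" 1 "real (n+1)"] by simp

text \<open>The Mahler measure is multiplicative and the height is not. Comparing the two in both
  directions makes heights multiplicative up to a constant.\<close>

lemma gelfond_inequality:
  assumes "degree (P * Q) \<le> n" "P \<noteq> 0" "Q \<noteq> 0"
  shows "real_of_int (poly_height P) * real_of_int (poly_height Q)
         \<le> gelfond_const n * real_of_int (poly_height (P * Q))"
proof -
  have deg: "degree P \<le> n" "degree Q \<le> n"
    using assms by (auto simp: degree_mult_eq)
  have "real_of_int (poly_height P) * real_of_int (poly_height Q) \<le>
      (2 ^ n * mahler_measure P) * (2 ^ n * mahler_measure Q)"
    using deg height_ge_1[OF assms(3)]
    by (intro mult_mono height_le_mahler_measure mult_nonneg_nonneg mahler_measure_ge_0) auto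
  also have "\<dots> = 4 ^ n * (mahler_measure P * mahler_measure Q)"
    using power_mult_distrib[of "2::real" 2 n] by simp
  also have "mahler_measure P * mahler_measure Q = mahler_measure (P * Q)"
    unfolding mahler_measure_def of_int_poly_hom.hom_mult by (simp add: measure_eq_prod)
  also have "4 ^ n * mahler_measure (P * Q) \<le> 4 ^ n * (real (n + 1) * real_of_int (poly_height (P * Q)))"
    by (intro mult_left_mono mahler_measure_le_height assms) auto
  finally show ?thesis by (simp add: gelfond_const_def mult_ac)
qed

lemma height_dvd_le:
  assumes "P dvd Q" "Q \<noteq> 0" "degree Q \<le> n"
  shows "real_of_int (poly_height P) \<le> gelfond_const n * real_of_int (poly_height Q)"
proof -
  obtain R where R: "Q = P * R" using assms(1) by auto
  have "real_of_int (poly_height P) * 1 \<le> real_of_int (poly_height P) * real_of_int (poly_height R)"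
    using assms R height_ge_1[of P] height_ge_1[of R] by (intro mult_left_mono) auto
  also have "\<dots> \<le> gelfond_const n * real_of_int (poly_height Q)"
    unfolding R using assms R by (intro gelfond_inequality) auto
  finally show ?thesis by simp
qed

subsection \<open>Approximation of real polynomials by integer polynomials\<close>

lemma coeff_sum_monom: "coeff (\<Sum>i\<le>n. monom (c i) i) j = (if j \<le> n then c j else 0)"
  by (simp add: coeff_sum coeff_monom)

lemma degree_sum_monom_le: "degree (\<Sum>i\<le>n. monom (c i) i) \<le> n"
  by (rule degree_le) (simp add: coeff_sum_monom)

lemma int_poly_eval_le:
  "degree P \<le> n \<Longrightarrow> int_poly_eval P x = (\<Sum>i\<le>n. real_of_int (coeff P i) * x ^ i)"
  by (subst poly_eq_sum_le[of _ n]) (auto simp: coeff_map_poly)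

lemma sum_abs_powers_ge_1: "1 \<le> (\<Sum>i\<le>n. \<bar>x\<bar> ^ i)" for x :: real
proof -
  have "(\<Sum>i\<in>{0}. \<bar>x\<bar> ^ i) \<le> (\<Sum>i\<le>n. \<bar>x\<bar> ^ i)" by (rule sum_mono2) auto
  thus ?thesis by simp
qed

text \<open>Pigeonhole principle on the polynomials with coefficients in \<open>{0..M}\<close>,
  where \<open>M\<close> is the integer part of \<open>Y\<close>: two of them have close values at
  \<open>x\<close>, and \<open>B\<close> is their difference.\<close>

lemma dirichlet_polynomial:
  fixes x Y :: real
  assumes r: "1 \<le> r" and Y: "1 \<le> Y"
  shows "\<exists>B. B \<noteq> 0 \<and> degree B \<le> r \<and> real_of_int (poly_height B) \<le> Y \<and>
    \<bar>int_poly_eval B x\<bar> \<le> 2 * (\<Sum>i\<le>r. \<bar>x\<bar> ^ i) / Y ^ r"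
proof -
  define M where "M = nat \<lfloor>Y\<rfloor>"
  define A where "A = (\<Sum>i\<le>r. \<bar>x\<bar> ^ i)"
  \<comment> \<open>The values \<open>v f\<close> fill a range of length at most
    \<open>2 * M * A\<close>. Cut into \<open>J\<close> cells, it has cells of length
    \<open>2 * A / (M + 1) ^ r\<close>, and \<open>Y < M + 1\<close>.\<close>
  define J where "J = M * (M + 1) ^ r"
  define v where "v = (\<lambda>f :: nat \<Rightarrow> nat. \<Sum>i\<le>r. real (f i) * x ^ i)"
  define D where "D = ({..r} \<rightarrow>\<^sub>E {0..M})"
  define b where "b = (\<lambda>f. \<lfloor>(v f + M * A) * (J / (2 * M * A))\<rfloor>)"
  have M: "1 \<le> M" "real M \<le> Y" "Y < real M + 1"
    using Y unfolding M_def by linarith+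
  have A: "1 \<le> A" unfolding A_def by (rule sum_abs_powers_ge_1)
  have J: "0 < J" using M by (simp add: J_def)
  have MA: "0 < 2 * real M * A" using M A by simp
  have v: "\<bar>v f\<bar> \<le> M * A" if "f \<in> D" for f
  proof -
    have "\<bar>v f\<bar> \<le> (\<Sum>i\<le>r. real M * \<bar>x\<bar> ^ i)"
      unfolding v_def
    proof (rule order_trans[OF sum_abs], rule sum_mono)
      fix i assume "i \<in> {..r}"
      hence "f i \<le> M" using that by (auto simp: D_def PiE_def Pi_def)
      thus "\<bar>real (f i) * x ^ i\<bar> \<le> real M * \<bar>x\<bar> ^ i"
        by (simp add: abs_mult power_abs mult_right_mono)
    qed
    thus ?thesis by (simp add: A_def sum_distrib_left)
  qed
  have "b ` D \<subseteq> {0..int J}"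
  proof
    fix y assume "y \<in> b ` D"
    then obtain f where f: "f \<in> D" "y = b f" by auto
    have "(v f + M * A) * (J / (2 * M * A)) \<le> (2 * M * A) * (J / (2 * M * A))"
    proof (rule mult_right_mono)
      show "v f + M * A \<le> 2 * M * A" using v[OF f(1)] by linarith
    qed (use MA in auto)
    also have "\<dots> = J" using M A by simp
    finally have "(v f + M * A) * (J / (2 * M * A)) \<le> J" .
    moreover have "0 \<le> (v f + M * A) * (J / (2 * M * A))"
      using v[OF f(1)] MA by (intro mult_nonneg_nonneg) auto
    \<comment> \<open>Index \<open>J\<close> may occur, at the right end of the range, so there are
      \<open>J + 1\<close> boxes.\<close>
    ultimately show "y \<in> {0..int J}" unfolding f b_def by (simp add: floor_le_iff)
  qed
  hence "card (b ` D) \<le> card {0..int J}" by (intro card_mono) auto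
  also have "\<dots> = J + 1" by simp
  \<comment> \<open>Here \<open>r >= 1\<close> enters: the extra box must cost less than
    \<open>(M + 1) ^ r\<close>.\<close>
  also have "J + 1 < J + (M + 1) ^ r"
    using M r one_less_power[of "M + 1" r] by simp
  also have "\<dots> = (M + 1) ^ (r + 1)" by (simp add: J_def)
  also have "\<dots> = card D" by (simp add: D_def card_PiE)
  finally have "\<not> inj_on b D" by (rule pigeonhole)
  then obtain f g where fg: "f \<in> D" "g \<in> D" "f \<noteq> g" "b f = b g"
    by (auto simp: inj_on_def)
  define B where "B = (\<Sum>i\<le>r. monom (int (f i) - int (g i)) i)"
  have cB: "coeff B i = (if i \<le> r then int (f i) - int (g i) else 0)" for i
    unfolding B_def by (rule coeff_sum_monom)
  have dB: "degree B \<le> r" unfolding B_def by (rule degree_sum_monom_le)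
  obtain i where i: "f i \<noteq> g i" using fg by auto
  have "i \<le> r" using fg(1,2) i unfolding D_def by (metis PiE_arb atMost_iff)
  hence "coeff B i \<noteq> 0" using i by (simp add: cB)
  hence B0: "B \<noteq> 0" by auto
  have "real_of_int (poly_height B) \<le> Y"
  proof (rule height_leI)
    fix i
    have "\<bar>real_of_int (coeff B i)\<bar> \<le> real M"
    proof (cases "i \<le> r")
      case True
      hence "f i \<le> M" "g i \<le> M" using fg by (auto simp: D_def PiE_def Pi_def)
      thus ?thesis using True by (simp add: cB)
    qed (simp add: cB)
    thus "\<bar>real_of_int (coeff B i)\<bar> \<le> Y" using M by linarith
  qed
  moreover have "\<bar>int_poly_eval B x\<bar> \<le> 2 * A / Y ^ r"
  proof -
    have e: "int_poly_eval B x = v f - v g"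
      unfolding int_poly_eval_le[OF dB] v_def by (simp add: cB left_diff_distrib sum_subtractf)
    have "\<bar>(v f + M * A) * (J / (2 * M * A)) - (v g + M * A) * (J / (2 * M * A))\<bar> < 1"
      using fg(4) unfolding b_def by linarith
    moreover have "(v f + M * A) * (J / (2 * M * A)) - (v g + M * A) * (J / (2 * M * A)) =
        (v f - v g) * (J / (2 * M * A))"
      unfolding left_diff_distrib[symmetric] by simp
    ultimately have "\<bar>v f - v g\<bar> * (J / (2 * M * A)) < 1"
      using M A by (simp add: abs_mult)
    hence "\<bar>v f - v g\<bar> < 2 * M * A / J"
      using MA J by (simp add: field_simps)
    also have "\<dots> = 2 * A / (real M + 1) ^ r"
      using M by (simp add: J_def field_simps)
    also have "\<dots> \<le> 2 * A / Y ^ r"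
      using A Y M by (intro divide_left_mono power_mono) auto
    finally show ?thesis unfolding e by simp
  qed
  ultimately show ?thesis using B0 dB unfolding A_def by blast
qed

section \<open>Bezout identities and coprime companions\<close>

text \<open>Coprimality over the integers is carried to the reals by the resultant: its nonvanishing
  survives the change of ring, and over a field it makes the gcd a unit.\<close>

lemma bezout_real:
  fixes E B :: "int poly"
  assumes "irreducible E" "\<not> E dvd B"
  obtains U V where "map_poly real_of_int E * U + map_poly real_of_int B * V = 1"
proof -
  have "prime_elem E" using assms(1) by (rule irreducible_imp_prime_elem)
  hence "Rings.coprime E B" using assms(2) by (rule prime_elem_imp_coprime)
  hence "resultant E B \<noteq> 0" by (simp add: resultant_0_gcd)
  hence "resultant (map_poly real_of_int E) (map_poly real_of_int B) \<noteq> 0"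
    by (simp add: of_int_hom.resultant_hom)
  hence d: "degree (gcd (map_poly real_of_int E) (map_poly real_of_int B)) = 0"
    by (simp add: resultant_0_gcd)
  have "E \<noteq> 0" using assms(1) by auto
  hence "gcd (map_poly real_of_int E) (map_poly real_of_int B) \<noteq> 0" by simp
  hence "is_unit (gcd (map_poly real_of_int E) (map_poly real_of_int B))"
    using d is_unit_iff_degree by blast
  hence g: "gcd (map_poly real_of_int E) (map_poly real_of_int B) = 1"
    by (simp only: is_unit_gcd coprime_iff_gcd_eq_1)
  show ?thesis
    using that[of "fst (bezout_coefficients (map_poly real_of_int E) (map_poly real_of_int B))"
        "snd (bezout_coefficients (map_poly real_of_int E) (map_poly real_of_int B))"]
      bezout_coefficients_fst_snd[of "map_poly real_of_int E" "map_poly real_of_int B"] g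
    by (simp add: mult.commute)
qed

text \<open>Reducing \<open>F * V0\<close> modulo \<open>E\<close> gives \<open>V\<close> of degree
  below that of \<open>E\<close>. Then \<open>E * U = F - B * V\<close> has degree at most
  \<open>n\<close>, which bounds the degree of \<open>U\<close>.\<close>

lemma bezout_degree_bounded:
  fixes E B F :: "real poly"
  assumes bez: "E * U0 + B * V0 = 1" and E: "1 \<le> degree E"
    and n: "degree E + degree B \<le> n" "degree F \<le> n"
  obtains U V where "F = E * U + B * V" "degree U \<le> n - degree E" "degree V \<le> n - degree B"
proof -
  define V where "V = (F * V0) mod E"
  define U where "U = F * U0 + B * ((F * V0) div E)"
  have E0: "E \<noteq> 0" using E by auto
  have V: "F * V0 = E * ((F * V0) div E) + V" unfolding V_def by simp
  have F: "F = E * U + B * V"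
  proof -
    have "F = F * (E * U0 + B * V0)" by (simp add: bez)
    also have "\<dots> = E * (F * U0) + B * (F * V0)" by (simp add: algebra_simps)
    also have "\<dots> = E * (F * U0) + B * (E * ((F * V0) div E) + V)" using V by simp
    also have "\<dots> = E * U + B * V" unfolding U_def by (simp add: algebra_simps)
    finally show ?thesis .
  qed
  have dV: "degree V < degree E"
    unfolding V_def using degree_mod_less'[of E "F * V0"] E E0
    by (cases "F * V0 mod E = 0") auto
  have "degree (E * U) \<le> n"
  proof -
    have "E * U = F - B * V" using F by (simp add: algebra_simps)
    moreover have "degree (B * V) \<le> n"
      using degree_mult_le[of B V] dV n by linarith
    ultimately show ?thesis using n by (simp add: degree_diff_le)
  qed
  hence "degree U \<le> n - degree E"
    using E0 by (cases "U = 0") (auto simp: degree_mult_eq)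
  thus ?thesis using that F dV n by simp
qed

text \<open>A Dirichlet polynomial whose height is below that of \<open>E\<close> by a constant factor cannot be a
  multiple of \<open>E\<close>; if \<open>E\<close> itself has bounded height, \<open>B = 1\<close> will do.\<close>

lemma coprime_companion:
  fixes \<zeta> c :: real
  assumes K: "1 \<le> K" and c: "0 < c"
    and bad: "\<And>E. 1 \<le> degree E \<Longrightarrow> degree E \<le> m \<Longrightarrow>
      c \<le> \<bar>int_poly_eval E \<zeta>\<bar> * real_of_int (poly_height E) ^ (K * degree E)"
  shows "\<exists>C\<ge>1. \<forall>E. irreducible E \<longrightarrow> 1 \<le> degree E \<longrightarrow> degree E \<le> m \<longrightarrow>
    (\<exists>B. degree B \<le> K * degree E \<and> \<not> E dvd B \<and>
      real_of_int (poly_height B) \<le> C * real_of_int (poly_height E) \<and>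
      \<bar>int_poly_eval B \<zeta>\<bar> \<le> C * \<bar>int_poly_eval E \<zeta>\<bar>)"
proof -
  \<comment> \<open>A multiple of \<open>E\<close> of height at most \<open>h / g\<close> would give
    \<open>h <= h / 2\<close> by Gelfond's inequality; this is the purpose of the factor 2.\<close>
  define g where "g = 2 * gelfond_const (K * m)"
  define A where "A = 2 * (\<Sum>i\<le>K * m. \<bar>\<zeta>\<bar> ^ i)"
  define C where "C = max 1 (A * g ^ (K * m) / c)"
  have g: "1 \<le> g" "0 < g" using gelfond_const_ge_1[of "K * m"] unfolding g_def by linarith+
  have A: "1 \<le> A" using sum_abs_powers_ge_1[of \<zeta> "K * m"] unfolding A_def by linarith
  have "\<exists>B. degree B \<le> K * degree E \<and> \<not> E dvd B \<and>
      real_of_int (poly_height B) \<le> C * real_of_int (poly_height E) \<and>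
      \<bar>int_poly_eval B \<zeta>\<bar> \<le> C * \<bar>int_poly_eval E \<zeta>\<bar>"
    if E: "irreducible E" "1 \<le> degree E" "degree E \<le> m" for E
  proof -
    define r where "r = K * degree E"
    define h where "h = real_of_int (poly_height E)"
    define q where "q = \<bar>int_poly_eval E \<zeta>\<bar>"
    have r: "1 \<le> r" "r \<le> K * m" using K E unfolding r_def by (auto simp: Suc_le_eq)
    have E0: "E \<noteq> 0" using E by auto
    have h: "1 \<le> h" using height_ge_1[OF E0] unfolding h_def by simp
    have cq: "c \<le> q * h ^ r" using bad[OF E(2,3)] unfolding q_def h_def r_def .
    have q: "0 \<le> q" by (simp add: q_def)
    have gs: "g ^ r \<le> g ^ (K * m)" using g r by (intro power_increasing) auto
    \<comment> \<open>Both cases below rest on this. For \<open>g <= h\<close> the left side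
      dominates Dirichlet's bound at height \<open>h / g\<close>, while \<open>bad\<close> gives
      \<open>c / h ^ r <= q\<close>. For \<open>h < g\<close> the left side is at least 1, so
      \<open>q\<close> is bounded below.\<close>
    have key: "A * (g / h) ^ r \<le> C * q"
    proof -
      have "A * (g / h) ^ r = A * g ^ r / h ^ r" by (simp add: power_divide)
      also have "\<dots> \<le> A * g ^ (K * m) / h ^ r"
        using gs A h by (intro divide_right_mono mult_left_mono) auto
      also have "\<dots> = (A * g ^ (K * m) / c) * (c / h ^ r)" using c by simp
      also have "\<dots> \<le> C * (c / h ^ r)"
        using c h unfolding C_def by (intro mult_right_mono) auto
      also have "\<dots> \<le> C * q"
        using cq h unfolding C_def by (intro mult_left_mono) (auto simp: divide_le_eq)
      finally show ?thesis .
    qed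
    show ?thesis
    proof (cases "g \<le> h")
      case True
      then obtain B where B: "B \<noteq> 0" "degree B \<le> r" "real_of_int (poly_height B) \<le> h / g"
        "\<bar>int_poly_eval B \<zeta>\<bar> \<le> 2 * (\<Sum>i\<le>r. \<bar>\<zeta>\<bar> ^ i) / (h / g) ^ r"
        using dirichlet_polynomial[of r "h / g" \<zeta>] r g by auto
      have "\<not> E dvd B"
      proof
        assume "E dvd B"
        hence "h \<le> gelfond_const (K * m) * real_of_int (poly_height B)"
          unfolding h_def using B r by (intro height_dvd_le) auto
        also have "\<dots> \<le> gelfond_const (K * m) * (h / g)"
          using B g unfolding g_def by (intro mult_left_mono) auto
        also have "\<dots> = h / 2" using g unfolding g_def by (simp add: field_simps)
        finally show False using h by simp
      qed
      moreover have "h / g \<le> C * h"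
      proof -
        have "h / g \<le> h / 1" using g h by (intro divide_left_mono) auto
        also have "\<dots> \<le> C * h" using h unfolding C_def by (simp add: mult_le_cancel_right1)
        finally show ?thesis .
      qed
      moreover have "\<bar>int_poly_eval B \<zeta>\<bar> \<le> C * q"
      proof -
        have "(\<Sum>i\<le>r. \<bar>\<zeta>\<bar> ^ i) \<le> (\<Sum>i\<le>K * m. \<bar>\<zeta>\<bar> ^ i)"
          using r by (intro sum_mono2) auto
        hence "2 * (\<Sum>i\<le>r. \<bar>\<zeta>\<bar> ^ i) * (g / h) ^ r \<le> A * (g / h) ^ r"
          unfolding A_def using g h by (intro mult_right_mono) auto
        moreover have "2 * (\<Sum>i\<le>r. \<bar>\<zeta>\<bar> ^ i) / (h / g) ^ r = 2 * (\<Sum>i\<le>r. \<bar>\<zeta>\<bar> ^ i) * (g / h) ^ r"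
          by (simp add: power_divide)
        ultimately show ?thesis using B(4) key by linarith
      qed
      ultimately show ?thesis using B unfolding h_def q_def r_def by (intro exI[of _ B]) auto
    next
      case False
      have "1 \<le> A * (g / h) ^ r"
      proof -
        have "1 \<le> (g / h) ^ r" using False h by (intro one_le_power) auto
        thus ?thesis using A mult_mono[of 1 A 1 "(g / h) ^ r"] by simp
      qed
      hence "1 \<le> C * q" using key by linarith
      moreover have "1 \<le> C * h" using h mult_mono[of 1 C 1 h] unfolding C_def by simp
      moreover have "\<not> E dvd 1" using E(1) by (simp add: irreducible_not_unit)
      moreover have "poly_height 1 = 1" by (simp add: poly_height_def)
      ultimately show ?thesis unfolding h_def q_def by (intro exI[of _ 1]) auto
    qed
  qed
  moreover have "1 \<le> C" unfolding C_def by simp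
  ultimately show ?thesis by blast
qed

text \<open>In the primitive part a constant prime divisor is impossible, since it would divide the
  content 1.\<close>

lemma exists_irreducible_factor:
  fixes P :: "int poly"
  assumes "1 \<le> degree P"
  obtains E where "irreducible E" "1 \<le> degree E" "E dvd P"
proof -
  let ?p = "primitive_part P"
  have P0: "P \<noteq> 0" using assms by auto
  have "\<not> is_unit ?p"
    using assms by (metis degree_primitive_part is_unit_polyE degree_pCons_0 not_one_le_zero)
  then obtain E where E: "E dvd ?p" "prime E"
    using prime_divisor_exists[of ?p] P0 by auto
  have "degree E \<noteq> 0"
  proof
    assume "degree E = 0"
    then obtain a where a: "E = [:a:]" using degree_eq_zeroE by blast
    have "a dvd content ?p" using E(1) unfolding a const_poly_dvd_iff_dvd_content .
    hence "is_unit a" using P0 by simp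
    hence "is_unit E" unfolding a by (simp add: is_unit_const_poly_iff)
    thus False using E(2) not_prime_unit by blast
  qed
  moreover have "irreducible E" using E(2) by (intro prime_elem_imp_irreducible prime_imp_prime_elem)
  moreover have "E dvd P"
    using E(1) by (metis content_times_primitive_part dvd_smult)
  ultimately show ?thesis using that[of E] by simp
qed

lemma round_polynomial:
  fixes F :: "real poly"
  assumes "degree F \<le> n"
  shows "\<exists>R. degree R \<le> n \<and> (\<forall>i. \<bar>coeff (map_poly real_of_int R - F) i\<bar> \<le> 1)"
proof -
  define R where "R = (\<Sum>i\<le>n. monom \<lfloor>coeff F i\<rfloor> i)"
  have "\<bar>coeff (map_poly real_of_int R - F) i\<bar> \<le> 1" for i
  proof (cases "i \<le> n")
    case True
    thus ?thesis by (simp add: R_def coeff_map_poly coeff_sum_monom) linarith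
  next
    case False
    thus ?thesis using assms by (simp add: R_def coeff_map_poly coeff_sum_monom coeff_eq_0)
  qed
  moreover have "degree R \<le> n" unfolding R_def by (rule degree_sum_monom_le)
  ultimately show ?thesis by blast
qed

text \<open>Splitting off an irreducible factor \<open>E\<close> of \<open>P\<close> with companion \<open>B\<close>, one writes
  \<open>F = E U + B V\<close> and approximates \<open>U\<close> and \<open>V\<close> with \<open>P / E\<close> in place of \<open>P\<close>.\<close>

lemma integer_approximation:
  fixes \<zeta> c :: real
  assumes K: "1 \<le> K" and c: "0 < c"
    and bad: "\<And>E. 1 \<le> degree E \<Longrightarrow> degree E \<le> m \<Longrightarrow>
      c \<le> \<bar>int_poly_eval E \<zeta>\<bar> * real_of_int (poly_height E) ^ (K * degree E)"
    and "d \<le> m"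
  shows "\<exists>C\<ge>1. \<forall>n\<le>N. \<forall>P F. P \<noteq> 0 \<longrightarrow> degree P \<le> d \<longrightarrow> (K + 1) * degree P \<le> n \<longrightarrow>
    degree F \<le> n \<longrightarrow> (\<exists>R. degree R \<le> n \<and>
      (\<forall>i. \<bar>coeff (map_poly real_of_int R - F) i\<bar> \<le> C * real_of_int (poly_height P)) \<and>
      \<bar>int_poly_eval R \<zeta> - poly F \<zeta>\<bar> \<le> C * \<bar>int_poly_eval P \<zeta>\<bar>)"
  using \<open>d \<le> m\<close>
proof (induction d)
  case 0
  define A where "A = (\<Sum>i\<le>N. \<bar>\<zeta>\<bar> ^ i)"
  have A: "1 \<le> A" unfolding A_def by (rule sum_abs_powers_ge_1)
  have "\<exists>R. degree R \<le> n \<and>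
      (\<forall>i. \<bar>coeff (map_poly real_of_int R - F) i\<bar> \<le> A * real_of_int (poly_height P)) \<and>
      \<bar>int_poly_eval R \<zeta> - poly F \<zeta>\<bar> \<le> A * \<bar>int_poly_eval P \<zeta>\<bar>"
    if n: "n \<le> N" and P: "P \<noteq> 0" "degree P \<le> 0" and F: "degree F \<le> n" for n P F
  proof -
    obtain R where R: "degree R \<le> n" "\<And>i. \<bar>coeff (map_poly real_of_int R - F) i\<bar> \<le> 1"
      using round_polynomial[OF F] by blast
    have d: "degree (map_poly real_of_int R - F) \<le> n"
      using R(1) F by (intro degree_diff_le) auto
    have "\<bar>poly (map_poly real_of_int R - F) \<zeta>\<bar> \<le> 1 * (\<Sum>i\<le>n. \<bar>\<zeta>\<bar> ^ i)"
      by (rule abs_poly_le[OF d R(2)])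
    also have "\<dots> \<le> 1 * A"
      unfolding A_def using n by (intro mult_left_mono sum_mono2) auto
    finally have v: "\<bar>int_poly_eval R \<zeta> - poly F \<zeta>\<bar> \<le> A" by simp
    \<comment> \<open>A nonzero integer constant has height and value at least 1 in absolute value,
      so plain rounding is already good enough.\<close>
    obtain a where a: "P = [:a:]" using P(2) by (auto elim: degree_eq_zeroE)
    hence "1 \<le> \<bar>real_of_int a\<bar>" using P(1) by auto
    hence "A * 1 \<le> A * \<bar>int_poly_eval P \<zeta>\<bar>"
      using A unfolding a by (intro mult_left_mono) auto
    moreover have "1 \<le> A * real_of_int (poly_height P)"
      using A height_ge_1_real[OF P(1)] mult_mono[of 1 A 1 "real_of_int (poly_height P)"] by simp
    ultimately show ?thesis
      using R v by (intro exI[of _ R]) (auto intro: order_trans)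
  qed
  thus ?case using A by blast
next
  case (Suc d)
  let ?H = "\<lambda>P. real_of_int (poly_height P)"
  obtain C1 where C1: "1 \<le> C1" and IH: "\<And>n P F. n \<le> N \<Longrightarrow> P \<noteq> 0 \<Longrightarrow> degree P \<le> d \<Longrightarrow>
      (K + 1) * degree P \<le> n \<Longrightarrow> degree F \<le> n \<Longrightarrow> \<exists>R. degree R \<le> n \<and>
        (\<forall>i. \<bar>coeff (map_poly real_of_int R - F) i\<bar> \<le> C1 * ?H P) \<and>
        \<bar>int_poly_eval R \<zeta> - poly F \<zeta>\<bar> \<le> C1 * \<bar>int_poly_eval P \<zeta>\<bar>"
    using Suc by auto
  obtain C2 where C2: "1 \<le> C2" and comp: "\<And>E. irreducible E \<Longrightarrow> 1 \<le> degree E \<Longrightarrow>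
      degree E \<le> m \<Longrightarrow> \<exists>B. degree B \<le> K * degree E \<and> \<not> E dvd B \<and>
        ?H B \<le> C2 * ?H E \<and> \<bar>int_poly_eval B \<zeta>\<bar> \<le> C2 * \<bar>int_poly_eval E \<zeta>\<bar>"
    using coprime_companion[OF K c bad] by blast
  \<comment> \<open>The factors come from two error terms (2), the convolution with \<open>E\<close>
    or \<open>B\<close> (\<open>K * m + 1\<close>), the induction (\<open>C1\<close>), the companion
    (\<open>C2\<close>), and the passage from the heights of \<open>E\<close> and \<open>Q\<close>
    to that of \<open>E * Q\<close>.\<close>
  define C where "C = 2 * real (K * m + 1) * C1 * C2 * gelfond_const m"
  have C: "C1 \<le> C" "1 \<le> C" "2 * C1 * C2 \<le> C"
  proof -
    have "1 * 1 \<le> real (K * m + 1) * gelfond_const m"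
      using gelfond_const_ge_1[of m] by (intro mult_mono) auto
    hence "2 * C1 * C2 * 1 \<le> 2 * C1 * C2 * (real (K * m + 1) * gelfond_const m)"
      using C1 C2 by (intro mult_left_mono) auto
    thus "2 * C1 * C2 \<le> C" unfolding C_def by (simp add: mult_ac)
    moreover have "C1 * 1 \<le> C1 * C2" using C1 C2 by (intro mult_left_mono) auto
    ultimately show "C1 \<le> C" "1 \<le> C" using C1 by linarith+
  qed
  have "\<exists>R. degree R \<le> n \<and>
      (\<forall>i. \<bar>coeff (map_poly real_of_int R - F) i\<bar> \<le> C * ?H P) \<and>
      \<bar>int_poly_eval R \<zeta> - poly F \<zeta>\<bar> \<le> C * \<bar>int_poly_eval P \<zeta>\<bar>"
    if n: "n \<le> N" and P: "P \<noteq> 0" "degree P \<le> Suc d" and nP: "(K + 1) * degree P \<le> n"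
      and F: "degree F \<le> n" for n P F
  proof (cases "degree P \<le> d")
    case True
    obtain R where R: "degree R \<le> n"
        "\<And>i. \<bar>coeff (map_poly real_of_int R - F) i\<bar> \<le> C1 * ?H P"
        "\<bar>int_poly_eval R \<zeta> - poly F \<zeta>\<bar> \<le> C1 * \<bar>int_poly_eval P \<zeta>\<bar>"
      using IH[OF n P(1) True nP F] by auto
    have "C1 * ?H P \<le> C * ?H P"
      using C(1) height_ge_1_real[OF P(1)] by (intro mult_right_mono) auto
    moreover have "C1 * \<bar>int_poly_eval P \<zeta>\<bar> \<le> C * \<bar>int_poly_eval P \<zeta>\<bar>"
      using C(1) by (intro mult_right_mono) auto
    ultimately show ?thesis using R by (intro exI[of _ R]) (auto intro: order_trans)
  next
    case False
    obtain E where E: "irreducible E" "1 \<le> degree E" "E dvd P"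
      using exists_irreducible_factor[of P] False by auto
    then obtain Q where Q: "P = E * Q" by auto
    have EQ: "E \<noteq> 0" "Q \<noteq> 0" using P Q by auto
    have dP: "degree P = degree E + degree Q" using Q EQ by (simp add: degree_mult_eq)
    have Em: "degree E \<le> m" "degree Q \<le> d" "degree P \<le> m"
      using dP P E Suc.prems by linarith+
    obtain B where B: "degree B \<le> K * degree E" "\<not> E dvd B" "?H B \<le> C2 * ?H E"
        "\<bar>int_poly_eval B \<zeta>\<bar> \<le> C2 * \<bar>int_poly_eval E \<zeta>\<bar>"
      using comp[OF E(1,2) Em(1)] by auto
    define rE where "rE = map_poly real_of_int E"
    define rB where "rB = map_poly real_of_int B"
    have deg: "degree rE = degree E" "degree rB = degree B" by (simp_all add: rE_def rB_def)
    obtain U0 V0 where bez: "rE * U0 + rB * V0 = 1"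
      using bezout_real[OF E(1) B(2)] unfolding rE_def rB_def .
    have nEQ: "(K + 1) * degree E + (K + 1) * degree Q \<le> n"
      using nP unfolding dP by (simp add: algebra_simps)
    \<comment> \<open>The budget \<open>(K + 1) * degree E\<close> leaves room for both
      \<open>E\<close> and \<open>B\<close>. Removing either one keeps
      \<open>(K + 1) * degree Q\<close> available, so the induction applies at the lower degrees
      \<open>n - degree E\<close> and \<open>n - degree B\<close>; hence the uniform constant for
      all \<open>n <= N\<close>.\<close>
    have n1: "(K + 1) * degree Q \<le> n - degree E" "(K + 1) * degree Q \<le> n - degree B"
      using nEQ B(1) by auto
    have nN: "n - degree E \<le> N" "n - degree B \<le> N" using n by linarith+
    have nb: "degree E + degree B \<le> n" using nEQ B(1) by auto
    obtain U V where UV: "F = rE * U + rB * V" "degree U \<le> n - degree E" "degree V \<le> n - degree B"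
      using bezout_degree_bounded[OF bez, of n F] E(2) nb F unfolding deg by blast
    obtain R1 where R1: "degree R1 \<le> n - degree E"
        "\<And>i. \<bar>coeff (map_poly real_of_int R1 - U) i\<bar> \<le> C1 * ?H Q"
        "\<bar>int_poly_eval R1 \<zeta> - poly U \<zeta>\<bar> \<le> C1 * \<bar>int_poly_eval Q \<zeta>\<bar>"
      using IH[OF nN(1) EQ(2) Em(2) n1(1) UV(2)] by blast
    obtain R2 where R2: "degree R2 \<le> n - degree B"
        "\<And>i. \<bar>coeff (map_poly real_of_int R2 - V) i\<bar> \<le> C1 * ?H Q"
        "\<bar>int_poly_eval R2 \<zeta> - poly V \<zeta>\<bar> \<le> C1 * \<bar>int_poly_eval Q \<zeta>\<bar>"
      using IH[OF nN(2) EQ(2) Em(2) n1(2) UV(3)] by blast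
    define R where "R = E * R1 + B * R2"
    have dR: "degree R \<le> n"
      unfolding R_def
    proof (rule degree_add_le)
      show "degree (E * R1) \<le> n" using degree_mult_le[of E R1] R1(1) nb by linarith
      show "degree (B * R2) \<le> n" using degree_mult_le[of B R2] R2(1) nb by linarith
    qed
    define D1 where "D1 = map_poly real_of_int R1 - U"
    define D2 where "D2 = map_poly real_of_int R2 - V"
    \<comment> \<open>The errors of \<open>R1\<close> and \<open>R2\<close> are of the size of
      \<open>Q\<close>, and they get multiplied by \<open>E\<close> and \<open>B\<close>, both of
      the size of \<open>E\<close> up to constants. The total is of the size of
      \<open>P\<close>.\<close>
    have diff: "map_poly real_of_int R - F = rE * D1 + rB * D2"
      unfolding R_def UV(1) D1_def D2_def rE_def rB_def
      by (simp add: of_int_poly_hom.hom_add of_int_poly_hom.hom_mult algebra_simps)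
    have HQ: "0 \<le> ?H Q" "0 \<le> ?H E" using height_ge_1_real[OF EQ(1)] height_ge_1_real[OF EQ(2)] by linarith+
    have "\<bar>coeff (map_poly real_of_int R - F) i\<bar> \<le> C * ?H P" for i
    proof -
      have a: "\<bar>coeff (rE * D1) i\<bar> \<le> real (K * m + 1) * (?H E * (C1 * ?H Q))"
      proof (rule abs_coeff_mult_le)
        have "degree E * 1 \<le> m * K" using Em(1) K by (intro mult_mono) auto
        thus "degree rE \<le> K * m" using deg by (simp add: mult.commute)
        show "\<bar>coeff rE i\<bar> \<le> ?H E" for i
          unfolding rE_def by (simp add: coeff_map_poly abs_coeff_le_height_real del: of_int_abs)
        show "\<bar>coeff D1 i\<bar> \<le> C1 * ?H Q" for i using R1(2) unfolding D1_def .
      qed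
      have b: "\<bar>coeff (rB * D2) i\<bar> \<le> real (K * m + 1) * ((C2 * ?H E) * (C1 * ?H Q))"
      proof (rule abs_coeff_mult_le)
        have "K * degree E \<le> K * m" using Em(1) by simp
        thus "degree rB \<le> K * m" using deg B(1) by linarith
        show "\<bar>coeff rB i\<bar> \<le> C2 * ?H E" for i
          unfolding rB_def using abs_coeff_le_height_real[of B i] B(3)
          by (simp add: coeff_map_poly del: of_int_abs)
        show "\<bar>coeff D2 i\<bar> \<le> C1 * ?H Q" for i using R2(2) unfolding D2_def .
      qed
      have "real (K * m + 1) * (?H E * (C1 * ?H Q)) \<le> real (K * m + 1) * ((C2 * ?H E) * (C1 * ?H Q))"
        using C1 C2 HQ by (intro mult_left_mono mult_right_mono) (auto simp: mult_le_cancel_right1)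
      hence "\<bar>coeff (map_poly real_of_int R - F) i\<bar> \<le> 2 * (real (K * m + 1) * ((C2 * ?H E) * (C1 * ?H Q)))"
        unfolding diff coeff_add using a b by linarith
      also have "\<dots> = 2 * real (K * m + 1) * C1 * C2 * (?H E * ?H Q)" by (simp only: mult_ac)
      also have "\<dots> \<le> 2 * real (K * m + 1) * C1 * C2 * (gelfond_const m * ?H P)"
        unfolding Q using C1 C2 Em(3) EQ Q
        by (intro mult_left_mono gelfond_inequality mult_nonneg_nonneg) auto
      finally show ?thesis unfolding C_def by (simp only: mult_ac)
    qed
    moreover have "\<bar>int_poly_eval R \<zeta> - poly F \<zeta>\<bar> \<le> C * \<bar>int_poly_eval P \<zeta>\<bar>"
    proof -
      let ?e = "\<bar>int_poly_eval E \<zeta>\<bar>" and ?q = "\<bar>int_poly_eval Q \<zeta>\<bar>"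
      have "int_poly_eval R \<zeta> - poly F \<zeta> = poly (rE * D1 + rB * D2) \<zeta>"
        unfolding diff[symmetric] by simp
      also have "\<bar>\<dots>\<bar> \<le> \<bar>poly rE \<zeta>\<bar> * \<bar>poly D1 \<zeta>\<bar> + \<bar>poly rB \<zeta>\<bar> * \<bar>poly D2 \<zeta>\<bar>"
        using abs_triangle_ineq[of "poly rE \<zeta> * poly D1 \<zeta>" "poly rB \<zeta> * poly D2 \<zeta>"]
        by (simp add: abs_mult)
      also have "\<dots> \<le> ?e * (C1 * ?q) + (C2 * ?e) * (C1 * ?q)"
        using R1(3) R2(3) B(4) C1 C2 unfolding D1_def D2_def rE_def rB_def
        by (intro add_mono mult_mono) auto
      also have "\<dots> \<le> (C2 * ?e) * (C1 * ?q) + (C2 * ?e) * (C1 * ?q)"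
        using C1 C2 by (intro add_mono mult_right_mono) (auto simp: mult_le_cancel_right1)
      also have "\<dots> = 2 * C1 * C2 * \<bar>int_poly_eval P \<zeta>\<bar>"
        unfolding Q by (simp add: of_int_poly_hom.hom_mult abs_mult)
      also have "\<dots> \<le> C * \<bar>int_poly_eval P \<zeta>\<bar>"
        using C(3) by (intro mult_right_mono) auto
      finally show ?thesis .
    qed
    ultimately show ?thesis using dR by blast
  qed
  thus ?case using C(2) by blast
qed

subsection \<open>Lower bounds for the uniform exponent\<close>

text \<open>Pseudo-division leaves a remainder that vanishes at \<open>\<alpha>\<close>, hence is
  zero by minimality. So \<open>P\<close> divides \<open>a\<close> times \<open>R\<close>, and
  Gauss's lemma with \<open>content P = 1\<close> cancels \<open>a\<close>.\<close>

lemma is_int_min_poly_dvd: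
  assumes P: "is_int_min_poly P \<alpha>" and R: "int_poly_eval R \<alpha> = 0"
  shows "P dvd R"
proof -
  have P0: "P \<noteq> 0" using P by (auto simp: is_int_min_poly_def)
  obtain a q where aq: "a \<noteq> 0" "smult a R = P * q + pseudo_mod R P"
    and r: "pseudo_mod R P = 0 \<or> degree (pseudo_mod R P) < degree P"
    using pseudo_mod[OF P0, of R] by blast
  have "int_poly_eval (smult a R) \<alpha> = int_poly_eval (P * q + pseudo_mod R P) \<alpha>"
    using aq by simp
  moreover have "map_poly real_of_int (smult a R) = smult (real_of_int a) (map_poly real_of_int R)"
    by (rule poly_eqI) (simp add: coeff_map_poly)
  ultimately have "int_poly_eval (pseudo_mod R P) \<alpha> = 0"
    using R P by (simp add: is_int_min_poly_def of_int_poly_hom.hom_add of_int_poly_hom.hom_mult)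
  hence "pseudo_mod R P = 0" using r P unfolding is_int_min_poly_def by (meson leD)
  hence eq: "smult a R = P * q" using aq by simp
  hence "content (smult a R) = content q" using P by (simp add: content_mult is_int_min_poly_def)
  hence "content q = normalize a * content R" by simp
  hence "a dvd content q" by simp
  hence "[:a:] dvd q" by (simp add: const_poly_dvd_iff_dvd_content)
  then obtain q' where "q = smult a q'" by (auto elim!: dvdE)
  hence "smult a R = smult a (P * q')" using eq by simp
  hence "R = P * q'" using aq(1) by (simp add: smult_cancel)
  thus ?thesis by simp
qed

text \<open>The minimal polynomial divides \<open>R\<close>, so a reducible \<open>R\<close> costs
  only the Gelfond constant in the height.\<close>

lemma algebraic_root:
  assumes R: "R \<noteq> 0" "degree R \<le> n" "int_poly_eval R \<alpha> = 0"
  shows "algebraic \<alpha>" "alg_degree \<alpha> \<le> n"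
    "real_of_int (alg_height \<alpha>) \<le> gelfond_const n * real_of_int (poly_height R)"
proof -
  show alg: "algebraic \<alpha>"
    using R by (intro algebraicI[of "map_poly of_int R"]) (auto simp: coeff_map_poly)
  have dvd: "int_min_poly \<alpha> dvd R"
    using is_int_min_poly_dvd[OF is_int_min_poly_int_min_poly[OF alg] R(3)] .
  show "alg_degree \<alpha> \<le> n" unfolding alg_degree_def using dvd_imp_degree_le[OF dvd R(1)] R(2) by linarith
  show "real_of_int (alg_height \<alpha>) \<le> gelfond_const n * real_of_int (poly_height R)"
    unfolding alg_height_def using height_dvd_le[OF dvd R(1,2)] .
qed

lemma alg_height_ge_1: "algebraic \<alpha> \<Longrightarrow> real_of_int (alg_height \<alpha>) \<ge> 1"
  unfolding alg_height_def using is_int_min_poly_int_min_poly[of \<alpha>]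
  by (intro height_ge_1_real) (auto simp: is_int_min_poly_def)

lemma eventually_le_powr:
  fixes a e :: real
  assumes "0 < e"
  shows "\<forall>\<^sub>F X in at_top. a \<le> X powr e"
  using eventually_ge_at_top[of "(max a 0) powr (1 / e)"]
proof eventually_elim
  case (elim X)
  have "a \<le> max a 0" by simp
  also have "\<dots> = ((max a 0) powr (1 / e)) powr e" using assms by (simp add: powr_powr)
  also have "\<dots> \<le> X powr e" using assms elim by (intro powr_mono2) auto
  finally show ?case .
qed

section \<open>From good approximations to the exponent\<close>

text \<open>The supremum absorbs constants: with \<open>Y = X / C\<close> and any
  \<open>w < m\<close>, the gain \<open>X powr (m - w)\<close> eventually exceeds
  \<open>D * C ^ m\<close>.\<close>

lemma w_hat_star_geI:
  fixes \<zeta> :: real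
  assumes C: "0 < C" "0 < D"
    and ex: "\<And>Y. Y \<ge> Y0 \<Longrightarrow> \<exists>\<alpha>. algebraic \<alpha> \<and> alg_degree \<alpha> \<le> n \<and>
      real_of_int (alg_height \<alpha>) \<le> C * Y \<and> \<bar>\<zeta> - \<alpha>\<bar> * real_of_int (alg_height \<alpha>) \<le> D / Y ^ m"
  shows "ereal (real m) \<le> w_hat_star n \<zeta>"
proof (rule dense_le)
  fix x :: ereal assume x: "x < ereal (real m)"
  show "x \<le> w_hat_star n \<zeta>"
  proof (cases x)
    case (real w)
    have w: "w < real m" using x real by simp
    have "\<forall>\<^sub>F X in at_top. D * C ^ m \<le> X powr (real m - w)"
      using w by (intro eventually_le_powr) auto
    moreover have "\<forall>\<^sub>F X in at_top. max 1 (C * Y0) \<le> (X :: real)" by (rule eventually_ge_at_top)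
    ultimately have "\<forall>\<^sub>F X :: real in at_top. \<exists>\<alpha> :: real. algebraic \<alpha> \<and> alg_degree \<alpha> \<le> n \<and>
         real_of_int (alg_height \<alpha>) \<le> X \<and>
         \<bar>\<zeta> - \<alpha>\<bar> \<le> inverse (real_of_int (alg_height \<alpha>)) * X powr (- w)"
    proof eventually_elim
      case (elim X)
      have X: "1 \<le> X" "Y0 \<le> X / C" using elim(2) C by (auto simp: field_simps)
      obtain \<alpha> where \<alpha>: "algebraic \<alpha>" "alg_degree \<alpha> \<le> n"
          "real_of_int (alg_height \<alpha>) \<le> C * (X / C)"
          "\<bar>\<zeta> - \<alpha>\<bar> * real_of_int (alg_height \<alpha>) \<le> D / (X / C) ^ m"
        using ex[OF X(2)] by auto
      have H: "1 \<le> real_of_int (alg_height \<alpha>)" using alg_height_ge_1[OF \<alpha>(1)] .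
      have "D / (X / C) ^ m = D * C ^ m / X powr (real m)"
        using X by (simp add: power_divide powr_realpow)
      also have "\<dots> \<le> X powr (real m - w) / X powr (real m)"
        using elim(1) by (intro divide_right_mono) auto
      also have "\<dots> = X powr (- w)" using X by (simp add: powr_diff powr_minus field_simps)
      finally have "\<bar>\<zeta> - \<alpha>\<bar> * real_of_int (alg_height \<alpha>) \<le> X powr (- w)" using \<alpha>(4) by linarith
      hence "\<bar>\<zeta> - \<alpha>\<bar> \<le> inverse (real_of_int (alg_height \<alpha>)) * X powr (- w)"
        using H by (simp add: field_simps)
      thus ?case using \<alpha> C by auto
    qed
    thus ?thesis unfolding w_hat_star_def real by (intro SUP_upper) simp
  qed (use x in auto)
qed

lemma w_hat_star_mono: "n \<le> n' \<Longrightarrow> w_hat_star n \<zeta> \<le> w_hat_star n' \<zeta>"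
  unfolding w_hat_star_def
  by (intro SUP_subset_mono) (auto elim!: eventually_mono intro: order_trans)

text \<open>An integer polynomial close to a large multiple of \<open>T - \<zeta>\<close> inherits
  its sign change at \<open>\<zeta>\<close>. The resulting root has height of order at most
  \<open>Y\<close> and distance from \<open>\<zeta>\<close> of order at most
  \<open>1 / Y ^ (m + 1)\<close>.\<close>

lemma w_hat_star_lower_bound:
  fixes \<zeta> c :: real
  assumes K: "1 \<le> K" and c: "0 < c" and m: "1 \<le> m"
    and bad: "\<And>E. 1 \<le> degree E \<Longrightarrow> degree E \<le> m \<Longrightarrow>
      c \<le> \<bar>int_poly_eval E \<zeta>\<bar> * real_of_int (poly_height E) ^ (K * degree E)"
  shows "ereal (real m) \<le> w_hat_star ((K + 1) * m) \<zeta>"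
proof -
  let ?H = "\<lambda>P. real_of_int (poly_height P)"
  define n where "n = (K + 1) * m"
  obtain C1 where C1: "1 \<le> C1" and approx: "\<And>P F. P \<noteq> 0 \<Longrightarrow> degree P \<le> m \<Longrightarrow>
      degree F \<le> n \<Longrightarrow> \<exists>R. degree R \<le> n \<and>
        (\<forall>i. \<bar>coeff (map_poly real_of_int R - F) i\<bar> \<le> C1 * ?H P) \<and>
        \<bar>int_poly_eval R \<zeta> - poly F \<zeta>\<bar> \<le> C1 * \<bar>int_poly_eval P \<zeta>\<bar>"
  proof -
    obtain C1 where C1: "1 \<le> C1" and *: "\<forall>n'\<le>n. \<forall>P F. P \<noteq> 0 \<longrightarrow> degree P \<le> m \<longrightarrow>
        (K + 1) * degree P \<le> n' \<longrightarrow> degree F \<le> n' \<longrightarrow> (\<exists>R. degree R \<le> n' \<and>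
        (\<forall>i. \<bar>coeff (map_poly real_of_int R - F) i\<bar> \<le> C1 * ?H P) \<and>
        \<bar>int_poly_eval R \<zeta> - poly F \<zeta>\<bar> \<le> C1 * \<bar>int_poly_eval P \<zeta>\<bar>)"
      using integer_approximation[where d = m and N = n and m = m, OF K c bad order_refl] by blast
    have "(K + 1) * degree P \<le> n" if "degree P \<le> m" for P :: "int poly"
      unfolding n_def using that by (intro mult_left_mono) auto
    thus ?thesis using that[of C1] C1 * by blast
  qed
  define A where "A = 2 * (\<Sum>i\<le>m. \<bar>\<zeta>\<bar> ^ i)"
  \<comment> \<open>Near \<open>\<zeta>\<close> the error \<open>D\<close> below has slope at most
    \<open>(L - 1) * Y\<close>, against slope \<open>L * Y\<close> of \<open>F\<close>. A net slope
    of at least \<open>Y\<close> remains.\<close>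
  define L where "L = C1 * lipschitz_const n \<zeta> + 1"
  define C2 where "C2 = L * (\<bar>\<zeta>\<bar> + 1) + C1"
  have A: "1 \<le> A" using sum_abs_powers_ge_1[of \<zeta> m] unfolding A_def by linarith
  have L: "1 \<le> L" unfolding L_def using C1 lipschitz_const_nonneg[of n \<zeta>] by simp
  have C2: "0 < C2" unfolding C2_def using L C1
    by (intro add_nonneg_pos mult_nonneg_nonneg) auto
  have g: "1 \<le> gelfond_const n" by (rule gelfond_const_ge_1)
  have CA: "0 < C1 * A" using C1 A by simp
  have "ereal (real m) \<le> w_hat_star n \<zeta>"
  proof (rule w_hat_star_geI)
    \<comment> \<open>The lower bound on \<open>Y\<close> ensures \<open>t <= 1\<close> below, as
      the Lipschitz estimate requires.\<close>
    fix Y :: real assume Y: "max 1 (2 * C1 * A) \<le> Y"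
    have Y1: "1 \<le> Y" using Y by simp
    obtain P where P: "P \<noteq> 0" "degree P \<le> m" "?H P \<le> Y" "\<bar>int_poly_eval P \<zeta>\<bar> \<le> A / Y ^ m"
      using dirichlet_polynomial[OF m Y1, of \<zeta>] unfolding A_def by blast
    define F where "F = [:- (L * Y * \<zeta>), L * Y:]"
    have "degree F \<le> n" unfolding F_def n_def using m by (simp add: Suc_le_eq)
    then obtain R where R: "degree R \<le> n"
        "\<And>i. \<bar>coeff (map_poly real_of_int R - F) i\<bar> \<le> C1 * ?H P"
        "\<bar>int_poly_eval R \<zeta> - poly F \<zeta>\<bar> \<le> C1 * \<bar>int_poly_eval P \<zeta>\<bar>"
      using approx[OF P(1,2)] by blast
    define D where "D = map_poly real_of_int R - F"
    define \<delta> where "\<delta> = C1 * A / Y ^ m"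
    \<comment> \<open>Over distance \<open>t\<close> the net slope gains
      \<open>t * Y = 2 * \<delta>\<close>, which beats the error \<open>\<delta>\<close> at
      \<open>\<zeta>\<close> and leaves values beyond \<open>\<delta>\<close> of either
      sign.\<close>
    define t where "t = 2 * \<delta> / Y"
    have \<delta>: "0 < \<delta>" unfolding \<delta>_def using CA Y1 by simp
    have C1P: "C1 * ?H P \<le> C1 * Y" using P(3) C1 by (intro mult_left_mono) auto
    have D: "\<bar>coeff D i\<bar> \<le> C1 * Y" for i using R(2)[of i] C1P unfolding D_def by linarith
    have dD: "degree D \<le> n"
      unfolding D_def using R(1) \<open>degree F \<le> n\<close> by (intro degree_diff_le) auto
    have D\<zeta>: "\<bar>poly D \<zeta>\<bar> \<le> \<delta>"
    proof -
      have "C1 * \<bar>int_poly_eval P \<zeta>\<bar> \<le> C1 * (A / Y ^ m)"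
        using P(4) C1 by (intro mult_left_mono) auto
      thus ?thesis using R(3) unfolding D_def \<delta>_def by simp
    qed
    have t: "0 < t" "t \<le> 1"
    proof -
      show "0 < t" unfolding t_def using \<delta> Y1 by simp
      have "2 * \<delta> \<le> 2 * C1 * A / 1"
        unfolding \<delta>_def using CA Y1 one_le_power[OF Y1, of m] divide_left_mono[of 1 "Y ^ m" "C1 * A"]
        by simp
      hence "2 * \<delta> \<le> Y" using Y by simp
      thus "t \<le> 1" unfolding t_def using Y1 by simp
    qed
    have bound: "\<bar>int_poly_eval R (\<zeta> + u) - L * Y * u\<bar> \<le> \<delta> + (L - 1) * Y * t"
      if u: "\<bar>u\<bar> = t" for u
    proof -
      have "\<bar>poly D (\<zeta> + u) - poly D \<zeta>\<bar> \<le> (C1 * Y) * lipschitz_const n \<zeta> * \<bar>(\<zeta> + u) - \<zeta>\<bar>"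
        by (rule poly_lipschitz[OF dD D]) (use u t in auto)
      also have "\<dots> = (L - 1) * Y * t" unfolding L_def using u by simp
      finally have 1: "\<bar>poly D (\<zeta> + u) - poly D \<zeta>\<bar> \<le> (L - 1) * Y * t" .
      have "int_poly_eval R (\<zeta> + u) - poly F (\<zeta> + u) = poly D (\<zeta> + u)"
        unfolding D_def by simp
      moreover have "poly F (\<zeta> + u) = L * Y * u" unfolding F_def by (simp add: algebra_simps)
      ultimately show ?thesis using 1 D\<zeta> by linarith
    qed
    have tY: "t * Y = 2 * \<delta>" unfolding t_def using Y1 by simp
    have pos: "\<delta> \<le> int_poly_eval R (\<zeta> + t)"
    proof -
      have "L * Y * t - (\<delta> + (L - 1) * Y * t) = t * Y - \<delta>" by (simp add: algebra_simps)
      also have "\<dots> = \<delta>" using tY by simp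
      finally show ?thesis using bound[of t] t by auto
    qed
    have neg: "int_poly_eval R (\<zeta> - t) \<le> - \<delta>"
    proof -
      have "L * Y * (-t) + (\<delta> + (L - 1) * Y * t) = \<delta> - t * Y" by (simp add: algebra_simps)
      also have "\<dots> = - \<delta>" using tY by simp
      finally show ?thesis using bound[of "- t"] t by auto
    qed
    have "continuous_on {\<zeta> - t..\<zeta> + t} (int_poly_eval R)" by (intro continuous_intros)
    then obtain \<alpha> where \<alpha>: "\<zeta> - t \<le> \<alpha>" "\<alpha> \<le> \<zeta> + t" "int_poly_eval R \<alpha> = 0"
      using IVT'[of "int_poly_eval R" "\<zeta> - t" 0 "\<zeta> + t"] pos neg \<delta> t by auto
    have R0: "R \<noteq> 0" using pos \<delta> by auto
    have HR: "?H R \<le> C2 * Y"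
    proof (rule height_leI)
      fix i
      have "\<bar>coeff F i\<bar> \<le> L * Y * (\<bar>\<zeta>\<bar> + 1)"
      proof -
        have LY: "0 \<le> L * Y" using L Y1 by simp
        have "\<bar>coeff F i\<bar> \<le> max (L * Y * \<bar>\<zeta>\<bar>) (L * Y)"
          using L Y1 LY unfolding F_def
          by (auto simp: coeff_pCons abs_mult le_max_iff_disj split: nat.splits)
        also have "\<dots> \<le> L * Y * (\<bar>\<zeta>\<bar> + 1)"
          using LY by (simp add: distrib_left)
        finally show ?thesis .
      qed
      moreover have "real_of_int (coeff R i) = coeff D i + coeff F i"
        unfolding D_def by (simp add: coeff_map_poly)
      ultimately have "\<bar>real_of_int (coeff R i)\<bar> \<le> L * Y * (\<bar>\<zeta>\<bar> + 1) + C1 * Y"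
        using D[of i] by linarith
      thus "\<bar>real_of_int (coeff R i)\<bar> \<le> C2 * Y" unfolding C2_def by (simp add: algebra_simps)
    qed
    note alg = algebraic_root[OF R0 R(1) \<alpha>(3)]
    have ht: "real_of_int (alg_height \<alpha>) \<le> gelfond_const n * C2 * Y"
      using alg(3) mult_left_mono[OF HR, of "gelfond_const n"] g unfolding mult.assoc by linarith
    \<comment> \<open>The factor \<open>Y\<close> in the height turns \<open>t\<close> into
      \<open>t * Y = 2 * \<delta>\<close>, of order \<open>1 / Y ^ m\<close>.\<close>
    have "\<bar>\<zeta> - \<alpha>\<bar> * real_of_int (alg_height \<alpha>) \<le> t * (gelfond_const n * C2 * Y)"
      using \<alpha> ht t alg_height_ge_1[OF alg(1)] by (intro mult_mono) auto
    also have "\<dots> = (t * Y) * gelfond_const n * C2" by (simp only: mult_ac)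
    also have "\<dots> = (2 * gelfond_const n * C2 * C1 * A) / Y ^ m"
      unfolding tY \<delta>_def by simp
    finally show "\<exists>\<alpha>. algebraic \<alpha> \<and> alg_degree \<alpha> \<le> n \<and>
        real_of_int (alg_height \<alpha>) \<le> gelfond_const n * C2 * Y \<and>
        \<bar>\<zeta> - \<alpha>\<bar> * real_of_int (alg_height \<alpha>) \<le> (2 * gelfond_const n * C2 * C1 * A) / Y ^ m"
      using alg(1,2) ht by blast
  qed (use g C2 CA in \<open>auto simp: mult.assoc\<close>)
  thus ?thesis unfolding n_def .
qed

text \<open>The root of a linear Dirichlet polynomial with leading coefficient \<open>q\<close> is
  at distance \<open>|P(\<zeta>)| / |q|\<close>, while the height is at most
  \<open>|q| * (|\<zeta>| + 1)\<close>. This covers the small degrees left over by the general lower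
  bound.\<close>

lemma w_hat_star_1_ge_1: "1 \<le> w_hat_star 1 \<zeta>"
proof -
  define A where "A = 2 * (\<Sum>i\<le>1. \<bar>\<zeta>\<bar> ^ i)"
  define C where "C = gelfond_const 1 * (\<bar>\<zeta>\<bar> + 1)"
  have A: "1 \<le> A" using sum_abs_powers_ge_1[of \<zeta> 1] unfolding A_def by linarith
  have g: "1 \<le> gelfond_const 1" by (rule gelfond_const_ge_1)
  have "ereal (real 1) \<le> w_hat_star 1 \<zeta>"
  proof (rule w_hat_star_geI)
    fix Y :: real assume Y: "A + 1 \<le> Y"
    obtain P where P: "P \<noteq> 0" "degree P \<le> 1" "real_of_int (poly_height P) \<le> Y"
        "\<bar>int_poly_eval P \<zeta>\<bar> \<le> A / Y ^ 1"
      using dirichlet_polynomial[of 1 Y \<zeta>] A Y unfolding A_def by auto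
    define p q where "p = coeff P 0" and "q = coeff P 1"
    have ev: "int_poly_eval P x = p + q * x" for x :: real
      unfolding int_poly_eval_le[OF P(2)] p_def q_def by simp
    have cP: "coeff P i = (if i = 0 then p else if i = 1 then q else 0)" for i
    proof -
      have "coeff P i = 0" if "2 \<le> i" using P(2) that by (intro coeff_eq_0) auto
      moreover have "i = 0 \<or> i = 1 \<or> 2 \<le> i" by linarith
      ultimately show ?thesis unfolding p_def q_def by (elim disjE) simp_all
    qed
    \<comment> \<open>A value below 1 forces \<open>q\<close> to be nonzero, and bounds
      \<open>p\<close> in terms of \<open>q\<close>.\<close>
    have small: "\<bar>p + q * \<zeta>\<bar> < 1"
    proof -
      have "A / Y < 1" using Y A by simp
      thus ?thesis using P(4) unfolding ev by simp
    qed
    have q0: "q \<noteq> 0"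
    proof
      assume "q = 0"
      hence "p = 0" using small by simp
      hence "P = 0" using \<open>q = 0\<close> by (intro poly_eqI) (simp add: cP)
      thus False using P(1) by simp
    qed
    hence q1: "1 \<le> \<bar>real_of_int q\<bar>" by simp
    define \<alpha> where "\<alpha> = - real_of_int p / real_of_int q"
    have "int_poly_eval P \<alpha> = 0" unfolding ev \<alpha>_def using q0 by simp
    note alg = algebraic_root[OF P(1,2) this]
    have HP: "real_of_int (poly_height P) \<le> \<bar>real_of_int q\<bar> * (\<bar>\<zeta>\<bar> + 1)"
    proof (rule height_leI)
      fix i
      have "\<bar>real_of_int p\<bar> \<le> \<bar>q * \<zeta>\<bar> + 1" using small by linarith
      also have "\<dots> \<le> \<bar>real_of_int q\<bar> * (\<bar>\<zeta>\<bar> + 1)"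
        using q1 by (simp add: distrib_left abs_mult)
      finally have "\<bar>real_of_int p\<bar> \<le> \<bar>real_of_int q\<bar> * (\<bar>\<zeta>\<bar> + 1)" .
      moreover have "\<bar>real_of_int q\<bar> \<le> \<bar>real_of_int q\<bar> * (\<bar>\<zeta>\<bar> + 1)" by (simp add: distrib_left)
      ultimately show "\<bar>real_of_int (coeff P i)\<bar> \<le> \<bar>real_of_int q\<bar> * (\<bar>\<zeta>\<bar> + 1)"
        by (simp add: cP)
    qed
    have "\<zeta> - \<alpha> = (p + q * \<zeta>) / q" unfolding \<alpha>_def using q0 by (simp add: add_divide_distrib)
    hence "\<bar>\<zeta> - \<alpha>\<bar> = \<bar>int_poly_eval P \<zeta>\<bar> / \<bar>real_of_int q\<bar>"
      unfolding ev by (simp only: abs_divide)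
    also have "\<dots> \<le> (A / Y) / \<bar>real_of_int q\<bar>"
      using P(4) by (intro divide_right_mono) auto
    finally have d: "\<bar>\<zeta> - \<alpha>\<bar> \<le> (A / Y) / \<bar>real_of_int q\<bar>" .
    have "real_of_int (alg_height \<alpha>) \<le> gelfond_const 1 * (\<bar>real_of_int q\<bar> * (\<bar>\<zeta>\<bar> + 1))"
      using alg(3) mult_left_mono[OF HP, of "gelfond_const 1"] g by linarith
    hence "\<bar>\<zeta> - \<alpha>\<bar> * real_of_int (alg_height \<alpha>) \<le>
        ((A / Y) / \<bar>real_of_int q\<bar>) * (gelfond_const 1 * (\<bar>real_of_int q\<bar> * (\<bar>\<zeta>\<bar> + 1)))"
      using d alg_height_ge_1[OF alg(1)] A Y by (intro mult_mono) auto
    also have "\<dots> = (A * C) / Y ^ 1" unfolding C_def using q0 by simp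
    finally have "\<bar>\<zeta> - \<alpha>\<bar> * real_of_int (alg_height \<alpha>) \<le> (A * C) / Y ^ 1" .
    moreover have "real_of_int (alg_height \<alpha>) \<le> gelfond_const 1 * Y"
      using alg(3) mult_left_mono[OF P(3), of "gelfond_const 1"] g by linarith
    ultimately show "\<exists>\<alpha>. algebraic \<alpha> \<and> alg_degree \<alpha> \<le> 1 \<and>
        real_of_int (alg_height \<alpha>) \<le> gelfond_const 1 * Y \<and>
        \<bar>\<zeta> - \<alpha>\<bar> * real_of_int (alg_height \<alpha>) \<le> (A * C) / Y ^ 1"
      using alg(1,2) by blast
  next
    show "0 < A * C" unfolding C_def using A g
      by (intro mult_pos_pos add_nonneg_pos) auto
  qed (use g in auto)
  thus ?thesis by (simp add: one_ereal_def)
qed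

subsection \<open>A lower bound from the resultant\<close>

text \<open>The new matrix is \<open>S * U\<close>, where \<open>U\<close> is the identity except
  for a last column of powers of \<open>x\<close>. It is upper triangular with unit diagonal, the
  corner entry being \<open>x ^ 0\<close>.\<close>

lemma det_replace_last_column:
  fixes S :: "real mat"
  assumes S: "S \<in> carrier_mat N N" and N: "0 < N"
  shows "Determinant.det (Matrix.mat N N (\<lambda>(i, j). if j = N - 1
      then \<Sum>k<N. S $$ (i, k) * x ^ (N - 1 - k) else S $$ (i, j))) = Determinant.det S"
    (is "Determinant.det ?T = _")
proof -
  define U where "U = Matrix.mat N N (\<lambda>(k, j). if j = N - 1 then x ^ (N - 1 - k)
      else if k = j then 1 else 0)"
  have U: "U \<in> carrier_mat N N" unfolding U_def by simp
  have "?T = S * U"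
  proof (rule eq_matI)
    fix i j assume ij: "i < dim_row (S * U)" "j < dim_col (S * U)"
    hence ij: "i < N" "j < N" using S U by auto
    have "(S * U) $$ (i, j) = (\<Sum>k<N. S $$ (i, k) * U $$ (k, j))"
      using S U ij by (simp add: scalar_prod_def atLeast0LessThan)
    also have "\<dots> = ?T $$ (i, j)"
    proof (cases "j = N - 1")
      case True
      thus ?thesis using ij unfolding U_def by simp
    next
      case False
      have "(\<Sum>k<N. S $$ (i, k) * U $$ (k, j)) = (\<Sum>k<N. if k = j then S $$ (i, j) else 0)"
        using False ij unfolding U_def by (intro sum.cong) auto
      also have "\<dots> = S $$ (i, j)" using ij by simp
      finally show ?thesis using False ij by simp
    qed
    finally show "?T $$ (i, j) = (S * U) $$ (i, j)" by simp
  qed (use S U in auto)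
  hence "Determinant.det ?T = Determinant.det S * Determinant.det U"
    using det_mult[OF S U] by simp
  also have "Determinant.det U = prod_list (diag_mat U)"
    using U by (intro det_upper_triangular) (auto simp: upper_triangular_def U_def)
  also have "\<dots> = (\<Prod>i<N. U $$ (i, i))"
    using U by (simp add: prod_list_diag_prod atLeast0LessThan)
  also have "\<dots> = 1" unfolding U_def by (intro prod.neutral) auto
  finally show ?thesis by simp
qed

text \<open>Each product in the Leibniz formula takes exactly one entry from the last column and
  thus picks up the factor \<open>v\<close> exactly once.\<close>

lemma abs_det_le:
  fixes T :: "real mat"
  assumes T: "T \<in> carrier_mat N N" and N: "0 < N"
    and h: "\<And>i. i < N \<Longrightarrow> 0 \<le> h i" and v: "0 \<le> v"
    and le: "\<And>i j. i < N \<Longrightarrow> j < N \<Longrightarrow> \<bar>T $$ (i, j)\<bar> \<le> h i * (if j = N - 1 then v else 1)"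
  shows "\<bar>Determinant.det T\<bar> \<le> fact N * (v * (\<Prod>i<N. h i))"
proof -
  have "\<bar>Determinant.det T\<bar> \<le> (\<Sum>p | p permutes {0..<N}. \<bar>signof p * (\<Prod>i = 0..<N. T $$ (i, p i))\<bar>)"
    unfolding Determinant.det_def'[OF T] by (rule sum_abs)
  also have "\<dots> \<le> (\<Sum>p | p permutes {0..<N}. v * (\<Prod>i<N. h i))"
  proof (rule sum_mono)
    fix p assume "p \<in> {p. p permutes {0..<N}}"
    hence p: "p permutes {0..<N}" by simp
    have "\<bar>signof p * (\<Prod>i = 0..<N. T $$ (i, p i))\<bar> = (\<Prod>i = 0..<N. \<bar>T $$ (i, p i)\<bar>)"
      by (simp add: abs_mult abs_prod sign_def)
    also have "\<dots> \<le> (\<Prod>i = 0..<N. h i * (if p i = N - 1 then v else 1))"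
    proof (rule prod_mono, safe)
      fix i assume i: "i \<in> {0..<N}"
      hence "p i \<in> {0..<N}" using permutes_in_image[OF p] by blast
      thus "\<bar>T $$ (i, p i)\<bar> \<le> h i * (if p i = N - 1 then v else 1)"
        using i le by auto
    qed simp
    also have "\<dots> = (\<Prod>i = 0..<N. h i) * (\<Prod>i = 0..<N. (if p i = N - 1 then v else 1))"
      by (rule prod.distrib)
    \<comment> \<open>Reindexing by the permutation shows that the last column is met once.\<close>
    also have "(\<Prod>i = 0..<N. (if p i = N - 1 then v else 1)) = (\<Prod>i = 0..<N. (if i = N - 1 then v else 1))"
      using prod.permute[OF p, of "\<lambda>i. if i = N - 1 then v else 1"] by (simp add: o_def)
    also have "\<dots> = v" using N by simp
    finally show "\<bar>signof p * (\<Prod>i = 0..<N. T $$ (i, p i))\<bar> \<le> v * (\<Prod>i<N. h i)"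
      by (simp add: atLeast0LessThan mult.commute)
  qed
  also have "\<dots> = fact N * (v * (\<Prod>i<N. h i))"
    using card_permutations[of "{0..<N}" N] by simp
  finally show ?thesis .
qed

text \<open>The rows of the Sylvester matrix list, highest power first, the coefficients of
  \<open>p\<close> and \<open>q\<close> times powers of the variable; pairing with the powers of
  \<open>x\<close> evaluates them.\<close>

lemma sylvester_row_eval:
  fixes p q :: "real poly"
  defines "N \<equiv> degree p + degree q"
  assumes i: "i < N"
  shows "(\<Sum>k<N. sylvester_mat p q $$ (i, k) * x ^ (N - 1 - k)) =
    (if i < degree q then x ^ (degree q - 1 - i) * poly p x else x ^ (N - 1 - i) * poly q x)"
proof (cases "i < degree q")
  case True
  let ?t = "\<lambda>k. sylvester_mat p q $$ (i, k) * x ^ (N - 1 - k)"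
  have "(\<Sum>k<N. ?t k) = (\<Sum>k\<in>{i..i + degree p}. ?t k)"
    using True i unfolding N_def
    by (intro sum.mono_neutral_right) (auto simp: sylvester_index_mat)
  also have "\<dots> = (\<Sum>a\<le>degree p. coeff p a * x ^ a * x ^ (degree q - 1 - i))"
  proof (rule sum.reindex_bij_witness[of _ "\<lambda>a. i + degree p - a" "\<lambda>k. i + degree p - k"])
    fix k assume k: "k \<in> {i..i + degree p}"
    have "N - 1 - k = (i + degree p - k) + (degree q - 1 - i)" using k True unfolding N_def by auto
    hence "x ^ (N - 1 - k) = x ^ (i + degree p - k) * x ^ (degree q - 1 - i)"
      by (simp only: power_add)
    moreover have "sylvester_mat p q $$ (i, k) = coeff p (i + degree p - k)"
      using k True i unfolding N_def by (subst sylvester_index_mat) (auto simp: add.commute)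
    ultimately show "coeff p (i + degree p - k) * x ^ (i + degree p - k) * x ^ (degree q - 1 - i) = ?t k"
      by simp
  qed auto
  also have "\<dots> = x ^ (degree q - 1 - i) * poly p x"
    by (simp add: poly_altdef sum_distrib_left mult.commute)
  finally show ?thesis using True by simp
next
  case False
  let ?t = "\<lambda>k. sylvester_mat p q $$ (i, k) * x ^ (N - 1 - k)"
  have "(\<Sum>k<N. ?t k) = (\<Sum>k\<in>{i - degree q..i}. ?t k)"
    using False i unfolding N_def
    by (intro sum.mono_neutral_right) (auto simp: sylvester_index_mat)
  also have "\<dots> = (\<Sum>a\<le>degree q. coeff q a * x ^ a * x ^ (N - 1 - i))"
  proof (rule sum.reindex_bij_witness[of _ "\<lambda>a. i - a" "\<lambda>k. i - k"])
    fix k assume k: "k \<in> {i - degree q..i}"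
    have "N - 1 - k = (i - k) + (N - 1 - i)" using k i by auto
    hence "x ^ (N - 1 - k) = x ^ (i - k) * x ^ (N - 1 - i)" by (simp only: power_add)
    moreover have "sylvester_mat p q $$ (i, k) = coeff q (i - k)"
      using k False i unfolding N_def by (subst sylvester_index_mat) auto
    ultimately show "coeff q (i - k) * x ^ (i - k) * x ^ (N - 1 - i) = ?t k" by simp
  qed (use False in auto)
  also have "\<dots> = x ^ (N - 1 - i) * poly q x"
    by (simp add: poly_altdef sum_distrib_left mult.commute)
  finally show ?thesis using False by simp
qed

text \<open>The resultant is a nonzero integer, so at least 1 in absolute value. After the column
  replacement the last column of the Sylvester matrix consists of multiples of \<open>P(x)\<close>
  and \<open>Q(x)\<close>, and the other entries are bounded by the heights.\<close>

lemma resultant_lower_bound: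
  fixes P Q :: "int poly" and x :: real
  assumes res: "resultant P Q \<noteq> 0" and P: "P \<noteq> 0" "degree P \<le> n" and Q: "Q \<noteq> 0" "degree Q \<le> m"
  shows "1 \<le> fact (n + m) * max 1 \<bar>x\<bar> ^ (n + m) *
    (real_of_int (poly_height P) ^ m * real_of_int (poly_height Q) ^ n *
      (\<bar>int_poly_eval P x\<bar> + \<bar>int_poly_eval Q x\<bar>))"
proof -
  let ?HP = "real_of_int (poly_height P)" and ?HQ = "real_of_int (poly_height Q)"
  define p q where "p = map_poly real_of_int P" and "q = map_poly real_of_int Q"
  define N where "N = degree p + degree q"
  define X where "X = max 1 \<bar>x\<bar>"
  define v where "v = \<bar>poly p x\<bar> + \<bar>poly q x\<bar>"
  have deg: "degree p = degree P" "degree q = degree Q" unfolding p_def q_def by simp_all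
  have HP: "1 \<le> ?HP" and HQ: "1 \<le> ?HQ" using P Q height_ge_1_real by auto
  have X: "1 \<le> X" unfolding X_def by simp
  have v: "0 \<le> v" unfolding v_def by simp
  have Nnm: "N \<le> n + m" using P Q deg unfolding N_def by simp
  \<comment> \<open>First with the exact degrees; since heights and \<open>X\<close> are at least 1,
    exponents may then be raised to \<open>n\<close> and \<open>m\<close>.\<close>
  have main: "1 \<le> fact N * X ^ N * (?HP ^ degree Q * ?HQ ^ degree P * v)"
  \<comment> \<open>For two constants the matrix is empty and has no last column; a nonzero integer
    value then suffices.\<close>
  proof (cases "N = 0")
    case True
    then obtain a where a: "P = [:a:]" using deg unfolding N_def by (auto elim: degree_eq_zeroE)
    have "1 \<le> \<bar>real_of_int a\<bar>" using P(1) a by simp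
    hence "1 \<le> v" unfolding v_def p_def a by simp
    thus ?thesis using True deg unfolding N_def by simp
  next
    case False
    let ?S = "sylvester_mat p q"
    let ?h = "\<lambda>i. if i < degree q then ?HP else ?HQ"
    let ?T = "Matrix.mat N N (\<lambda>(i, j). if j = N - 1
      then \<Sum>k<N. ?S $$ (i, k) * x ^ (N - 1 - k) else ?S $$ (i, j))"
    have S: "?S \<in> carrier_mat N N" unfolding N_def by (rule sylvester_carrier_mat)
    have "real_of_int (resultant P Q) = resultant p q"
      unfolding p_def q_def by (simp add: of_int_hom.resultant_hom)
    also have "\<dots> = Determinant.det ?T"
      unfolding resultant_def using det_replace_last_column[OF S] False by simp
    finally have "1 \<le> \<bar>Determinant.det ?T\<bar>" using res by linarith
    also have "\<bar>Determinant.det ?T\<bar> \<le> fact N * ((X ^ N * v) * (\<Prod>i<N. ?h i))"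
    proof (rule abs_det_le)
      fix i j assume ij: "i < N" "j < N"
      show "\<bar>?T $$ (i, j)\<bar> \<le> ?h i * (if j = N - 1 then X ^ N * v else 1)"
      proof (cases "j = N - 1")
        case True
        have pw: "\<bar>x\<bar> ^ a \<le> X ^ N" if "a \<le> N" for a
        proof -
          have "\<bar>x\<bar> ^ a \<le> X ^ a" unfolding X_def by (intro power_mono) auto
          also have "\<dots> \<le> X ^ N" using that X by (intro power_increasing) auto
          finally show ?thesis .
        qed
        have "\<bar>?T $$ (i, j)\<bar> \<le> X ^ N * v"
        proof (cases "i < degree q")
          case iq: True
          have "\<bar>?T $$ (i, j)\<bar> = \<bar>x\<bar> ^ (degree q - 1 - i) * \<bar>poly p x\<bar>"
            using True ij iq sylvester_row_eval[of i p q x]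
            unfolding N_def by (simp add: abs_mult power_abs)
          also have "\<dots> \<le> X ^ N * v"
            unfolding v_def using X by (intro mult_mono pw) (auto simp: N_def)
          finally show ?thesis .
        next
          case iq: False
          have "\<bar>?T $$ (i, j)\<bar> = \<bar>x\<bar> ^ (N - 1 - i) * \<bar>poly q x\<bar>"
            using True ij iq sylvester_row_eval[of i p q x]
            unfolding N_def by (simp add: abs_mult power_abs)
          also have "\<dots> \<le> X ^ N * v"
            unfolding v_def using X by (intro mult_mono pw) (auto simp: N_def)
          finally show ?thesis .
        qed
        also have "\<dots> \<le> ?h i * (X ^ N * v)"
          using HP HQ X v mult_right_mono[of 1 "?h i" "X ^ N * v"] by simp
        finally show ?thesis using True by simp
      next
        case False
        have cP: "\<bar>coeff p a\<bar> \<le> ?HP" for a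
          unfolding p_def using abs_coeff_le_height_real[of P a] by (simp add: coeff_map_poly)
        have cQ: "\<bar>coeff q a\<bar> \<le> ?HQ" for a
          unfolding q_def using abs_coeff_le_height_real[of Q a] by (simp add: coeff_map_poly)
        have "?T $$ (i, j) = ?S $$ (i, j)" using ij False by simp
        thus ?thesis using ij False HP HQ cP cQ unfolding N_def
          by (auto simp: sylvester_index_mat)
      qed
    qed (use False HP HQ X v in auto)
    also have "(\<Prod>i<N. ?h i) = ?HP ^ degree Q * ?HQ ^ degree P"
    proof -
      have "(\<Prod>i<N. ?h i) = (\<Prod>i\<in>{..<degree q}. ?HP) * (\<Prod>i\<in>{degree q..<N}. ?HQ)"
      proof -
        have "{..<N} = {..<degree q} \<union> {degree q..<N}" unfolding N_def by auto
        hence "(\<Prod>i<N. ?h i) = (\<Prod>i\<in>{..<degree q}. ?h i) * (\<Prod>i\<in>{degree q..<N}. ?h i)"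
          by (simp add: prod.union_disjoint ivl_disj_int)
        thus ?thesis by simp
      qed
      thus ?thesis unfolding N_def using deg by simp
    qed
    finally show ?thesis by (simp only: mult_ac)
  qed
  also have "\<dots> \<le> fact (n + m) * X ^ (n + m) * (?HP ^ m * ?HQ ^ n * v)"
    using Nnm HP HQ X v P Q
    by (intro mult_mono power_increasing fact_mono) auto
  finally show ?thesis unfolding X_def v_def p_def q_def .
qed

subsection \<open>Bounding the uniform exponent by the ordinary one\<close>

lemma transcendental_eval_nonzero:
  assumes "\<not> algebraic \<zeta>" "P \<noteq> 0"
  shows "int_poly_eval P \<zeta> \<noteq> 0"
  using assms algebraic_root(1)[OF assms(2) order_refl] by blast

lemma w_exponent_mono: "n \<le> n' \<Longrightarrow> w_exponent n \<zeta> \<le> w_exponent n' \<zeta>"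
  unfolding w_exponent_def
  by (intro SUP_subset_mono) (auto elim!: infinite_super[rotated])

text \<open>Only finitely many polynomials violate the bound with constant 1. Transcendence keeps
  their values at \<open>\<zeta>\<close> nonzero, so a minimum over them is positive.\<close>

lemma w_exponent_less_imp_bound:
  assumes tr: "\<not> algebraic \<zeta>" and w: "w_exponent n \<zeta> < ereal w"
  shows "\<exists>c>0. \<forall>P. P \<noteq> 0 \<longrightarrow> degree P \<le> n \<longrightarrow>
    c \<le> \<bar>int_poly_eval P \<zeta>\<bar> * real_of_int (poly_height P) powr w"
proof -
  define S where "S = {P :: int poly. degree P \<le> n \<and> 0 < \<bar>int_poly_eval P \<zeta>\<bar> \<and>
    \<bar>int_poly_eval P \<zeta>\<bar> \<le> real_of_int (poly_height P) powr (- w)}"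
  define f where "f = (\<lambda>P. \<bar>int_poly_eval P \<zeta>\<bar> * real_of_int (poly_height P) powr w)"
  \<comment> \<open>The element 1 serves the polynomials outside \<open>S\<close>, and covers the
    case of empty \<open>S\<close>.\<close>
  define c where "c = Min (insert 1 (f ` S))"
  have fin: "finite S"
  proof (rule ccontr)
    assume "infinite S"
    hence "ereal w \<le> w_exponent n \<zeta>" unfolding w_exponent_def S_def by (intro SUP_upper) simp
    thus False using w by simp
  qed
  have "0 < f P" if "P \<in> S" for P
  proof -
    have "P \<noteq> 0" using that unfolding S_def by auto
    hence "0 < real_of_int (poly_height P)" using height_ge_1_real[of P] by linarith
    thus ?thesis using that unfolding f_def S_def by simp
  qed
  hence "0 < c" unfolding c_def using fin by (subst Min_gr_iff) auto
  moreover have "c \<le> f P" if P: "P \<noteq> 0" "degree P \<le> n" for P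
  proof (cases "P \<in> S")
    case True
    thus ?thesis unfolding c_def using fin by (intro Min_le) auto
  next
    case False
    let ?h = "real_of_int (poly_height P)"
    have h: "0 < ?h" using height_ge_1_real[OF P(1)] by linarith
    have "?h powr (- w) < \<bar>int_poly_eval P \<zeta>\<bar>"
      using False P transcendental_eval_nonzero[OF tr P(1)] unfolding S_def by auto
    hence "?h powr (- w) * ?h powr w < f P"
      unfolding f_def using h by (intro mult_strict_right_mono) auto
    hence "1 < f P" using h by (simp add: powr_add[symmetric])
    moreover have "c \<le> 1" unfolding c_def using fin by (intro Min_le) auto
    ultimately show ?thesis by linarith
  qed
  ultimately show ?thesis unfolding f_def by blast
qed

text \<open>The companions need the exponent \<open>K * degree E\<close>, adapted to each factor.
  Hence one bound for each degree \<open>e\<close>, with the least of the finitely many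
  constants.\<close>

lemma w_hat_star_ge:
  assumes tr: "\<not> algebraic \<zeta>" and K: "1 \<le> K" and m: "1 \<le> m"
    and w: "\<And>e. 1 \<le> e \<Longrightarrow> e \<le> m \<Longrightarrow> w_exponent e \<zeta> < ereal (real (K * e))"
  shows "ereal (real m) \<le> w_hat_star ((K + 1) * m) \<zeta>"
proof -
  have "\<forall>e\<in>{1..m}. \<exists>c>0. \<forall>P. P \<noteq> 0 \<longrightarrow> degree P \<le> e \<longrightarrow>
      c \<le> \<bar>int_poly_eval P \<zeta>\<bar> * real_of_int (poly_height P) powr real (K * e)"
    using w_exponent_less_imp_bound[OF tr w] by auto
  from bchoice[OF this] obtain c where c: "\<forall>e\<in>{1..m}. c e > 0 \<and> (\<forall>P. P \<noteq> 0 \<longrightarrow> degree P \<le> e \<longrightarrow>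
      c e \<le> \<bar>int_poly_eval P \<zeta>\<bar> * real_of_int (poly_height P) powr real (K * e))" ..
  define c0 where "c0 = Min (c ` {1..m})"
  have c0: "0 < c0" unfolding c0_def using c m by (subst Min_gr_iff) auto
  show ?thesis
  proof (rule w_hat_star_lower_bound[OF K c0 m])
    fix E :: "int poly" assume E: "1 \<le> degree E" "degree E \<le> m"
    have E0: "E \<noteq> 0" using E by auto
    hence h: "0 < real_of_int (poly_height E)" using height_ge_1_real[of E] by linarith
    have "c0 \<le> c (degree E)" unfolding c0_def using E by (intro Min_le) auto
    also have "\<dots> \<le> \<bar>int_poly_eval E \<zeta>\<bar> * real_of_int (poly_height E) powr real (K * degree E)"
      using bspec[OF c, of "degree E"] E E0 by auto
    finally show "c0 \<le> \<bar>int_poly_eval E \<zeta>\<bar> * real_of_int (poly_height E) ^ (K * degree E)"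
      unfolding powr_realpow[OF h] .
  qed
qed

section \<open>Upper bounds through the resultant\<close>

text \<open>A common factor does not vanish at \<open>\<alpha>\<close>, since it divides
  \<open>Q\<close>. If nonconstant, it would leave a cofactor of \<open>P\<close> of smaller degree
  that vanishes at \<open>\<alpha>\<close>.\<close>

lemma resultant_int_min_poly_nonzero:
  assumes P: "is_int_min_poly P \<alpha>" and Q: "int_poly_eval Q \<alpha> \<noteq> 0"
  shows "resultant P Q \<noteq> 0"
proof
  assume "resultant P Q = 0"
  hence d: "degree (gcd P Q) \<noteq> 0" by (simp add: resultant_0_gcd)
  have P0: "P \<noteq> 0" using P by (auto simp: is_int_min_poly_def)
  obtain A where A: "P = gcd P Q * A" by (metis dvdE gcd_dvd1)
  obtain B where B: "Q = gcd P Q * B" by (metis dvdE gcd_dvd2)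
  have "int_poly_eval (gcd P Q * B) \<alpha> \<noteq> 0" using Q B by simp
  hence "int_poly_eval (gcd P Q) \<alpha> \<noteq> 0" by (auto simp: of_int_poly_hom.hom_mult)
  moreover have "int_poly_eval (gcd P Q * A) \<alpha> = 0"
    using P A by (simp add: is_int_min_poly_def)
  ultimately have "int_poly_eval A \<alpha> = 0" by (auto simp: of_int_poly_hom.hom_mult)
  moreover have A0: "A \<noteq> 0" "gcd P Q \<noteq> 0" using A P0 by auto
  ultimately have "degree P \<le> degree A" using P by (auto simp: is_int_min_poly_def)
  moreover have "degree P = degree (gcd P Q) + degree A"
    using A A0 by (metis degree_mult_eq)
  ultimately show False using d by linarith
qed

text \<open>Take \<open>Q\<close> of large height \<open>h\<close> with value
  \<open>q <= h powr (- w)\<close> at \<open>\<zeta>\<close>. The scale \<open>X\<close> is as large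
  as the resultant inequality permits with the term from \<open>Q\<close> at most 1/2. An exponent
  \<open>v\<close> beyond the bound then makes the other term too small as well.\<close>

lemma w_hat_star_le:
  assumes tr: "\<not> algebraic \<zeta>" and m: "1 \<le> m" and nw: "real n < w"
    and w: "ereal w < w_exponent m \<zeta>"
  shows "w_hat_star n \<zeta> \<le> ereal (real m + real (n + 1) * real m / (w - real n))"
  unfolding w_hat_star_def
proof (rule SUP_least, rule ccontr)
  let ?H = "\<lambda>P. real_of_int (poly_height P)"
  fix v :: real
  assume "v \<in> {w. \<forall>\<^sub>F X :: real in at_top.
       \<exists>\<alpha> :: real. algebraic \<alpha> \<and> alg_degree \<alpha> \<le> n \<and>
         real_of_int (alg_height \<alpha>) \<le> X \<and>
         \<bar>\<zeta> - \<alpha>\<bar> \<le> inverse (real_of_int (alg_height \<alpha>)) * X powr (- w)}"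
  then obtain X0 where X0: "\<And>X. X \<ge> X0 \<Longrightarrow> \<exists>\<alpha> :: real. algebraic \<alpha> \<and> alg_degree \<alpha> \<le> n \<and>
         real_of_int (alg_height \<alpha>) \<le> X \<and>
         \<bar>\<zeta> - \<alpha>\<bar> \<le> inverse (real_of_int (alg_height \<alpha>)) * X powr (- v)"
    by (auto simp: eventually_at_top_linorder)
  assume "\<not> ereal v \<le> ereal (real m + real (n + 1) * real m / (w - real n))"
  hence v: "real m + real (n + 1) * real m / (w - real n) < v" by simp
  \<comment> \<open>Chosen so that \<open>X powr (v - m) = y powr k\<close> when
    \<open>X ^ m = y\<close>. The assumption on \<open>v\<close> becomes \<open>kn\<close>.\<close>
  define k where "k = (v - real m) / real m"
  define G where "G = fact (n + m) * max 1 \<bar>\<zeta>\<bar> ^ (n + m)"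
  define L where "L = lipschitz_const n \<zeta> + lipschitz_const m \<zeta> + 1"
  define C where "C = (2 * G) powr k * (2 * G * L)"
  have m0: "0 < real m" using m by simp
  have "0 \<le> real (n + 1) * real m / (w - real n)" using nw by simp
  hence vm: "real m < v" using v by linarith
  have k0: "0 < k" unfolding k_def using vm m0 by simp
  have kn: "real (n + 1) < (w - real n) * k"
  proof -
    have "real (n + 1) * real m / (w - real n) < v - real m" using v by linarith
    hence "real (n + 1) * real m < (v - real m) * (w - real n)"
      using nw by (simp add: divide_less_eq)
    thus ?thesis unfolding k_def using m0 by (simp add: field_simps)
  qed
  have G: "1 \<le> G"
    unfolding G_def using mult_mono[of 1 "fact (n + m)" 1 "max 1 \<bar>\<zeta>\<bar> ^ (n + m)"] by simp
  have L: "1 \<le> L" "lipschitz_const n \<zeta> \<le> L" "lipschitz_const m \<zeta> \<le> L"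
    unfolding L_def using lipschitz_const_nonneg[of n \<zeta>] lipschitz_const_nonneg[of m \<zeta>] by linarith+
  \<comment> \<open>The first condition on \<open>h\<close> makes the scale \<open>X\<close>
    admissible, that is at least \<open>max 1 X0\<close>; the second one yields the final
    contradiction.\<close>
  have "\<forall>\<^sub>F h :: real in at_top. 2 * G * max 1 X0 ^ m \<le> h powr (w - real n)"
    using nw by (intro eventually_le_powr) auto
  moreover have "\<forall>\<^sub>F h :: real in at_top. C + 1 \<le> h powr ((w - real n) * k - real (n + 1))"
    using kn by (intro eventually_le_powr) auto
  ultimately have "\<forall>\<^sub>F h :: real in at_top. 2 * G * max 1 X0 ^ m \<le> h powr (w - real n) \<and>
      C + 1 \<le> h powr ((w - real n) * k - real (n + 1))"
    by (rule eventually_conj)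
  then obtain h0 where h0: "\<And>h. h \<ge> h0 \<Longrightarrow> 2 * G * max 1 X0 ^ m \<le> h powr (w - real n)"
      "\<And>h. h \<ge> h0 \<Longrightarrow> C + 1 \<le> h powr ((w - real n) * k - real (n + 1))"
    by (auto simp: eventually_at_top_linorder)

  obtain Q where Q: "degree Q \<le> m" "0 < \<bar>int_poly_eval Q \<zeta>\<bar>"
      "\<bar>int_poly_eval Q \<zeta>\<bar> \<le> ?H Q powr (- w)" "h0 \<le> ?H Q"
  proof -
    \<comment> \<open>Infinitely many polynomials of bounded degree have unbounded height, so one of
      height above \<open>h0\<close> exists for some \<open>w' > w\<close>.\<close>
    obtain w' where w': "ereal w < ereal w'" and inf: "infinite {P :: int poly. degree P \<le> m \<and>
       0 < \<bar>int_poly_eval P \<zeta>\<bar> \<and> \<bar>int_poly_eval P \<zeta>\<bar> \<le> ?H P powr (- w')}"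
      using w unfolding w_exponent_def less_SUP_iff by auto
    obtain Q where Q: "degree Q \<le> m" "0 < \<bar>int_poly_eval Q \<zeta>\<bar>"
      "\<bar>int_poly_eval Q \<zeta>\<bar> \<le> ?H Q powr (- w')" "\<not> poly_height Q \<le> \<lceil>h0\<rceil>"
    proof -
      have "\<not> {P :: int poly. degree P \<le> m \<and> 0 < \<bar>int_poly_eval P \<zeta>\<bar> \<and>
          \<bar>int_poly_eval P \<zeta>\<bar> \<le> ?H P powr (- w')} \<subseteq> {P. degree P \<le> m \<and> poly_height P \<le> \<lceil>h0\<rceil>}"
        using inf finite_bounded_height finite_subset by blast
      thus ?thesis using that by blast
    qed
    have "Q \<noteq> 0" using Q(2) by auto
    hence "?H Q powr (- w') \<le> ?H Q powr (- w)"
      using w' height_ge_1_real[of Q] by (intro powr_mono) auto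
    moreover have "h0 \<le> ?H Q" using Q(4) by linarith
    ultimately show ?thesis using Q that[of Q] by linarith
  qed
  define h where "h = ?H Q"
  define q where "q = \<bar>int_poly_eval Q \<zeta>\<bar>"
  \<comment> \<open>With \<open>X ^ m = y\<close> the contribution of \<open>q\<close> to the
    resultant inequality, at height \<open>X\<close> for \<open>P\<close>, is exactly 1/2.\<close>
  define y where "y = 1 / (2 * G * h ^ n * q)"
  define X where "X = y powr (1 / real m)"
  have Q0: "Q \<noteq> 0" using Q(2) by auto
  have h: "1 \<le> h" unfolding h_def using height_ge_1_real[OF Q0] .
  have q: "0 < q" using Q(2) unfolding q_def .
  have y0: "0 < y" unfolding y_def using G h q by simp
  have y: "h powr (w - real n) / (2 * G) \<le> y"
  proof -
    have "2 * G * h ^ n * q \<le> 2 * G * h ^ n * h powr (- w)"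
      using Q(3) G h unfolding q_def h_def by (intro mult_left_mono) auto
    also have "\<dots> = 2 * G / h powr (w - real n)"
      using h by (simp add: powr_diff powr_minus powr_realpow field_simps)
    finally have le: "2 * G * h ^ n * q \<le> 2 * G / h powr (w - real n)" .
    have "1 / (2 * G / h powr (w - real n)) \<le> y"
      unfolding y_def using le G h q by (intro divide_left_mono) auto
    thus ?thesis by simp
  qed
  have Xm: "X ^ m = y"
  proof -
    have "X ^ m = X powr real m" using y0 unfolding X_def by (simp add: powr_realpow)
    also have "\<dots> = y" unfolding X_def powr_powr using m0 y0 by simp
    finally show ?thesis .
  qed
  have X: "max 1 X0 \<le> X"
  proof (rule ccontr)
    assume "\<not> max 1 X0 \<le> X"
    hence "X < max 1 X0" unfolding not_le .
    hence "X ^ m < max 1 X0 ^ m"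
      using m unfolding X_def by (intro power_strict_mono) auto
    moreover have "max 1 X0 ^ m \<le> h powr (w - real n) / (2 * G)"
      using h0(1)[OF Q(4)] G unfolding h_def by (simp add: field_simps)
    ultimately show False using y Xm by linarith
  qed
  hence X1: "1 \<le> X" "X0 \<le> X" by auto
  obtain \<alpha> where \<alpha>: "algebraic \<alpha>" "alg_degree \<alpha> \<le> n" "real_of_int (alg_height \<alpha>) \<le> X"
      "\<bar>\<zeta> - \<alpha>\<bar> \<le> inverse (real_of_int (alg_height \<alpha>)) * X powr (- v)"
    using X0[OF X1(2)] by blast
  define P where "P = int_min_poly \<alpha>"
  have P: "is_int_min_poly P \<alpha>" unfolding P_def by (rule is_int_min_poly_int_min_poly[OF \<alpha>(1)])
  have P0: "P \<noteq> 0" using P by (auto simp: is_int_min_poly_def)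
  have dP: "degree P \<le> n" using \<alpha>(2) unfolding P_def alg_degree_def .
  have HP: "1 \<le> ?H P" "?H P \<le> X"
    using height_ge_1_real[OF P0] \<alpha>(3) unfolding P_def alg_height_def by auto
  have P\<alpha>: "int_poly_eval P \<alpha> = 0" using P by (simp add: is_int_min_poly_def)
  have dist: "?H P * \<bar>\<alpha> - \<zeta>\<bar> \<le> X powr (- v)"
  proof -
    have "?H P * \<bar>\<zeta> - \<alpha>\<bar> \<le> ?H P * (inverse (?H P) * X powr (- v))"
      using \<alpha>(4) HP unfolding P_def alg_height_def by (intro mult_left_mono) auto
    also have "\<dots> = X powr (- v)"
      using HP by (simp only: mult.assoc[symmetric]) simp
    finally show ?thesis by (simp add: abs_minus_commute)
  qed
  have dist': "\<bar>\<alpha> - \<zeta>\<bar> \<le> X powr (- v)"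
    using dist HP mult_right_mono[of 1 "?H P" "\<bar>\<alpha> - \<zeta>\<bar>"] by simp
  have Xv: "X powr (- v) \<le> 1"
    using X1 vm m0 powr_mono[of "- v" 0 X] by simp
  hence near: "\<bar>\<alpha> - \<zeta>\<bar> \<le> 1" using dist' by linarith
  \<comment> \<open>Both cases give the same inequality. If \<open>Q\<close> vanishes at
    \<open>\<alpha>\<close>, then \<open>q\<close> is at most \<open>h * L\<close> times
    \<open>X powr (- v)\<close>, which is the source of the exponent \<open>n + 1\<close>; otherwise
    the resultant gives it with exponent \<open>n\<close>.\<close>
  have key: "1 \<le> (2 * G * L) * h ^ (n + 1) * y * X powr (- v)"
  proof (cases "int_poly_eval Q \<alpha> = 0")
    case True
    have "\<bar>int_poly_eval Q \<alpha> - int_poly_eval Q \<zeta>\<bar> \<le> h * lipschitz_const m \<zeta> * \<bar>\<alpha> - \<zeta>\<bar>"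
      using Q(1) near unfolding h_def
      by (intro poly_lipschitz) (auto simp: coeff_map_poly abs_coeff_le_height_real simp del: of_int_abs)
    also have "\<dots> \<le> h * L * X powr (- v)"
      using h L dist' lipschitz_const_nonneg[of m \<zeta>] by (intro mult_mono) auto
    finally have "q \<le> h * L * X powr (- v)" using True unfolding q_def by simp
    moreover have "q = 1 / (2 * G * h ^ n * y)"
      unfolding y_def using G h q by simp
    ultimately have "1 / (2 * G * h ^ n * y) \<le> h * L * X powr (- v)" by simp
    thus ?thesis using G h y0 by (simp add: divide_le_eq mult_ac)
  next
    case False
    have res: "resultant P Q \<noteq> 0" by (rule resultant_int_min_poly_nonzero[OF P False])
    have "\<bar>int_poly_eval P \<alpha> - int_poly_eval P \<zeta>\<bar> \<le> ?H P * lipschitz_const n \<zeta> * \<bar>\<alpha> - \<zeta>\<bar>"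
      using dP near
      by (intro poly_lipschitz) (auto simp: coeff_map_poly abs_coeff_le_height_real simp del: of_int_abs)
    also have "\<dots> \<le> L * (?H P * \<bar>\<alpha> - \<zeta>\<bar>)"
      using HP L mult_right_mono[of "lipschitz_const n \<zeta>" L "?H P * \<bar>\<alpha> - \<zeta>\<bar>"] by (simp add: mult_ac)
    also have "\<dots> \<le> L * X powr (- v)"
      using dist L by (intro mult_left_mono) auto
    finally have P\<zeta>: "\<bar>int_poly_eval P \<zeta>\<bar> \<le> L * X powr (- v)" using P\<alpha> by simp
    have "1 \<le> G * (?H P ^ m * h ^ n * (\<bar>int_poly_eval P \<zeta>\<bar> + q))"
      using resultant_lower_bound[OF res P0 dP Q0 Q(1), of \<zeta>] unfolding G_def h_def q_def .
    also have "\<dots> \<le> G * (X ^ m * h ^ n * (L * X powr (- v) + q))"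
      using G HP h P\<zeta> q X1 L
      by (intro mult_left_mono mult_mono power_mono add_mono mult_nonneg_nonneg add_nonneg_nonneg) auto
    also have "\<dots> = G * y * h ^ n * (L * X powr (- v)) + G * y * h ^ n * q"
      unfolding Xm by (simp add: algebra_simps)
    also have "G * y * h ^ n * q = 1 / 2"
      unfolding y_def using G h q by simp
    finally have "1 \<le> (2 * G * L) * h ^ n * y * X powr (- v)" by (simp add: mult_ac)
    also have "\<dots> \<le> (2 * G * L) * h ^ (n + 1) * y * X powr (- v)"
      using G L h y0 by (intro mult_right_mono mult_left_mono power_increasing) auto
    finally show ?thesis .
  qed
  \<comment> \<open>Divide by \<open>X ^ m = y\<close>. Together with the lower bound for
    \<open>y\<close> this compares two powers of \<open>h\<close>, contradicting \<open>kn\<close>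
    for large \<open>h\<close>.\<close>
  have "y powr k \<le> 2 * G * L * h ^ (n + 1)"
  proof -
    have "X powr v = X powr (v - real m) * X powr real m"
      by (simp add: powr_add[symmetric])
    also have "X powr real m = y" using Xm X1 by (simp add: powr_realpow)
    also have "X powr (v - real m) = y powr k"
      unfolding X_def powr_powr k_def by simp
    finally have Xv: "X powr v = y powr k * y" .
    have "X powr v * 1 \<le> X powr v * ((2 * G * L) * h ^ (n + 1) * y * X powr (- v))"
      using key by (intro mult_left_mono) auto
    also have "\<dots> = (2 * G * L) * h ^ (n + 1) * y"
      using X1 by (simp add: powr_minus)
    finally have "y powr k * y \<le> (2 * G * L * h ^ (n + 1)) * y" unfolding Xv by simp
    thus ?thesis using y0 by simp
  qed
  moreover have "(h powr (w - real n) / (2 * G)) powr k \<le> y powr k"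
    using y k0 G by (intro powr_mono2) auto
  ultimately have "(h powr (w - real n) / (2 * G)) powr k \<le> 2 * G * L * h ^ (n + 1)" by linarith
  hence "h powr ((w - real n) * k) / (2 * G) powr k \<le> 2 * G * L * h powr real (n + 1)"
    using h G by (simp add: powr_divide powr_powr powr_realpow del: of_nat_Suc of_nat_add)
  hence "h powr ((w - real n) * k) \<le> C * h powr real (n + 1)"
    unfolding C_def using G by (simp add: divide_le_eq mult_ac)
  moreover have "h powr ((w - real n) * k) =
      h powr ((w - real n) * k - real (n + 1)) * h powr real (n + 1)"
    by (simp add: powr_add[symmetric])
  ultimately have "h powr ((w - real n) * k - real (n + 1)) \<le> C"
    using h by simp
  thus False using h0(2)[OF Q(4)] unfolding h_def by simp
qed

subsection \<open>Mahler classes\<close>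

text \<open>By monotonicity one \<open>K\<close> above \<open>w_m\<close> serves every degree
  \<open>e <= m\<close>. The size of \<open>K\<close> affects only \<open>N\<close>.\<close>

lemma w_exponent_finite_imp_w_hat_star_ge:
  assumes tr: "\<not> algebraic \<zeta>" and m: "1 \<le> m" and fin: "w_exponent m \<zeta> < \<infinity>"
  shows "\<exists>N. ereal (real m) \<le> w_hat_star N \<zeta>"
proof -
  obtain k :: nat where k: "w_exponent m \<zeta> < ereal (real k)"
    using less_PInf_Ex_of_nat[of "w_exponent m \<zeta>"] fin by auto
  define K where "K = max 1 k"
  have "w_exponent e \<zeta> < ereal (real (K * e))" if e: "1 \<le> e" "e \<le> m" for e
  proof -
    have "k \<le> K * e" using e mult_le_mono[of k K 1 e] unfolding K_def by simp
    hence "ereal (real k) \<le> ereal (real (K * e))" by (simp only: ereal_less_eq of_nat_le_iff)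
    thus ?thesis using w_exponent_mono[OF e(2), of \<zeta>] k by order
  qed
  hence "ereal (real m) \<le> w_hat_star ((K + 1) * m) \<zeta>"
    using m by (intro w_hat_star_ge[OF tr]) (auto simp: K_def)
  thus ?thesis by blast
qed

lemma w_hat_star_le_of_w_exponent_infinite:
  assumes tr: "\<not> algebraic \<zeta>" and m: "1 \<le> m" and inf: "w_exponent m \<zeta> = \<infinity>"
  shows "w_hat_star n \<zeta> \<le> ereal (real m)"
proof (rule ereal_le_epsilon2)
  fix e :: real assume e: "0 < e"
  \<comment> \<open>With \<open>w = n + d\<close> the second term of \<open>w_hat_star_le\<close>
    equals \<open>e\<close>.\<close>
  define d where "d = real (n + 1) * real m / e"
  have d: "0 < d" unfolding d_def using e m by simp
  have "w_hat_star n \<zeta> \<le> ereal (real m + real (n + 1) * real m / ((real n + d) - real n))"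
    using d inf by (intro w_hat_star_le[OF tr m]) auto
  also have "real (n + 1) * real m / ((real n + d) - real n) = e"
    unfolding d_def using e m by simp
  finally show "w_hat_star n \<zeta> \<le> ereal (real m) + ereal e" by simp
qed

lemma w_hat_star_ge_1: "1 \<le> n \<Longrightarrow> 1 \<le> w_hat_star n \<zeta>"
  by (rule order_trans[OF w_hat_star_1_ge_1 w_hat_star_mono])

lemma U_number_iff_w_exponent_infinite:
  "U_number \<zeta> \<longleftrightarrow> (\<exists>m\<ge>1. w_exponent m \<zeta> = \<infinity>)"
proof
  assume "\<exists>m\<ge>1. w_exponent m \<zeta> = \<infinity>"
  then obtain m where m: "1 \<le> m \<and> w_exponent m \<zeta> = \<infinity>"
    and least: "\<And>k. k < m \<Longrightarrow> \<not> (1 \<le> k \<and> w_exponent k \<zeta> = \<infinity>)"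
    using exists_least_iff[of "\<lambda>m. 1 \<le> m \<and> w_exponent m \<zeta> = \<infinity>"] by blast
  hence "Um_number m \<zeta>" unfolding Um_number_def by (auto simp: less_top)
  thus "U_number \<zeta>" unfolding U_number_def by blast
qed (auto simp: U_number_def Um_number_def)

lemma Um_number_imp_w_hat_star_bounds:
  assumes tr: "\<not> algebraic \<zeta>" and U: "Um_number m \<zeta>"
  shows "\<forall>\<^sub>F n in sequentially. w_hat_star n \<zeta> \<in> {ereal (real m - 1)..ereal (real m)}"
proof -
  have m: "1 \<le> m" "w_exponent m \<zeta> = \<infinity>" using U unfolding Um_number_def by auto
  have "\<exists>N. ereal (real m - 1) \<le> w_hat_star N \<zeta>"
  \<comment> \<open>For \<open>m = 1\<close> the lower bound is 0 and comes from degree one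
    directly; for larger \<open>m\<close> it comes from the finiteness of
    \<open>w_exponent (m - 1)\<close>.\<close>
  proof (cases "m = 1")
    case True
    have "ereal 0 \<le> ereal 1" by simp
    also have "\<dots> \<le> w_hat_star 1 \<zeta>" using w_hat_star_1_ge_1[of \<zeta>] by (simp add: one_ereal_def)
    finally show ?thesis using True by auto
  next
    case False
    hence "w_exponent (m - 1) \<zeta> < \<infinity>" using U m unfolding Um_number_def by auto
    moreover have "1 \<le> m - 1" using False m by simp
    ultimately have "\<exists>N. ereal (real (m - 1)) \<le> w_hat_star N \<zeta>"
      using w_exponent_finite_imp_w_hat_star_ge[OF tr] by blast
    thus ?thesis using m by (simp add: of_nat_diff)
  qed
  then obtain N where N: "ereal (real m - 1) \<le> w_hat_star N \<zeta>" by blast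
  show ?thesis
    using eventually_ge_at_top[of N]
  proof eventually_elim
    case (elim n)
    have "ereal (real m - 1) \<le> w_hat_star n \<zeta>" using N w_hat_star_mono[OF elim, of \<zeta>] by order
    thus ?case using w_hat_star_le_of_w_exponent_infinite[OF tr m] by simp
  qed
qed

section \<open>Limits and U-numbers\<close>

lemma w_hat_star_tendsto_SUP:
  "(\<lambda>n. w_hat_star n \<zeta>) \<longlonglongrightarrow> (SUP n. w_hat_star n \<zeta>)"
  by (intro LIMSEQ_SUP incseq_SucI w_hat_star_mono) simp

lemma not_U_number_imp_w_hat_star_tendsto:
  assumes tr: "\<not> algebraic \<zeta>" and U: "\<not> U_number \<zeta>"
  shows "(\<lambda>n. w_hat_star n \<zeta>) \<longlonglongrightarrow> \<infinity>"
  unfolding tendsto_PInfty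
proof
  fix r :: real
  obtain k :: nat where k: "r < real k" using reals_Archimedean2 by blast
  define m where "m = max 1 k"
  have "w_exponent m \<zeta> < \<infinity>"
    using U U_number_iff_w_exponent_infinite[of \<zeta>] unfolding m_def by (auto simp: less_top)
  then obtain N where N: "ereal (real m) \<le> w_hat_star N \<zeta>"
    using w_exponent_finite_imp_w_hat_star_ge[OF tr, of m] unfolding m_def by auto
  have rm: "ereal r < ereal (real m)" using k unfolding m_def by simp
  show "\<forall>\<^sub>F n in sequentially. ereal r < w_hat_star n \<zeta>"
    using eventually_ge_at_top[of N]
  proof eventually_elim
    case (elim n)
    show ?case using rm N w_hat_star_mono[OF elim, of \<zeta>] by order
  qed
qed

lemma U_number_imp_w_hat_star_bounded:
  assumes tr: "\<not> algebraic \<zeta>" and U: "U_number \<zeta>"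
  obtains m where "\<And>n. w_hat_star n \<zeta> \<le> ereal (real m)"
  using U w_hat_star_le_of_w_exponent_infinite[OF tr] that
  unfolding U_number_def Um_number_def by blast

lemma U_number_iff_w_hat_star_limit_finite:
  assumes tr: "\<not> algebraic \<zeta>"
  shows "U_number \<zeta> \<longleftrightarrow> (\<exists>L. (\<lambda>n. w_hat_star n \<zeta>) \<longlonglongrightarrow> L \<and> L < \<infinity>)"
proof
  assume "U_number \<zeta>"
  then obtain m where "\<And>n. w_hat_star n \<zeta> \<le> ereal (real m)"
    using U_number_imp_w_hat_star_bounded[OF tr] by blast
  hence "(SUP n. w_hat_star n \<zeta>) \<le> ereal (real m)" by (rule SUP_least)
  also have "\<dots> < \<infinity>" by simp
  finally show "\<exists>L. (\<lambda>n. w_hat_star n \<zeta>) \<longlonglongrightarrow> L \<and> L < \<infinity>"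
    using w_hat_star_tendsto_SUP[of \<zeta>] by blast
next
  assume "\<exists>L. (\<lambda>n. w_hat_star n \<zeta>) \<longlonglongrightarrow> L \<and> L < \<infinity>"
  thus "U_number \<zeta>"
    using not_U_number_imp_w_hat_star_tendsto[OF tr] LIMSEQ_unique less_irrefl by metis
qed

section \<open>Linear growth and S-numbers\<close>

text \<open>The choice \<open>n = M m\<close> with \<open>w_m > 2 n + 1\<close> makes the bound of \<open>w_hat_star_le\<close> equal to \<open>2 m\<close>.\<close>

lemma not_S_number_imp_w_hat_star_le:
  assumes tr: "\<not> algebraic \<zeta>" and S: "\<not> S_number \<zeta>"
  shows "\<exists>m\<ge>N. 1 \<le> m \<and> w_hat_star (M * m) \<zeta> \<le> ereal (2 * real m)"
proof -
  have "\<exists>m\<ge>max 1 N. ereal (real (2 * M + 1)) < w_exponent m \<zeta> / ereal (real m)"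
  proof (rule ccontr)
    assume "\<not> ?thesis"
    hence "\<forall>\<^sub>F m in sequentially. w_exponent m \<zeta> / ereal (real m) \<le> ereal (real (2 * M + 1))"
      unfolding eventually_sequentially by (meson not_le)
    hence "limsup (\<lambda>m. w_exponent m \<zeta> / ereal (real m)) \<le> ereal (real (2 * M + 1))"
      by (rule Limsup_bounded)
    also have "\<dots> < \<infinity>" by simp
    finally show False using S unfolding S_number_def by simp
  qed
  then obtain m where m: "max 1 N \<le> m" "ereal (real (2 * M + 1)) < w_exponent m \<zeta> / ereal (real m)"
    by blast
  have m1: "1 \<le> m" "N \<le> m" using m(1) by auto
  have "ereal (real m) * ereal (real (2 * M + 1)) < w_exponent m \<zeta>"
    using m(2) m1 by (subst (asm) ereal_less_divide_pos) auto
  \<comment> \<open>With \<open>n = M * m\<close> and \<open>w = 2 * n + 1\<close> the denominator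
    \<open>w - n\<close> is \<open>n + 1\<close> and cancels.\<close>
  moreover have "ereal (2 * real (M * m) + 1) \<le> ereal (real m) * ereal (real (2 * M + 1))"
    using m1 by (simp add: algebra_simps)
  ultimately have "ereal (2 * real (M * m) + 1) < w_exponent m \<zeta>" by order
  hence "w_hat_star (M * m) \<zeta> \<le> ereal (real m + real (M * m + 1) * real m /
      ((2 * real (M * m) + 1) - real (M * m)))"
  proof (intro w_hat_star_le[OF tr m1(1)])
    have "0 \<le> real (M * m)" by simp
    thus "real (M * m) < 2 * real (M * m) + 1" by linarith
  qed
  also have "(2 * real (M * m) + 1) - real (M * m) = real (M * m + 1)" by simp
  also have "real (M * m + 1) * real m / real (M * m + 1) = real m"
    by (rule nonzero_mult_div_cancel_left) (metis Suc_eq_plus1 of_nat_eq_0_iff nat.distinct(1))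
  also have "real m + real m = 2 * real m" by simp
  finally show ?thesis using m1 by blast
qed

text \<open>Along \<open>n = M * m\<close> with \<open>\<delta> * M > 2\<close>, linear growth
  exceeds the bound \<open>2 * m\<close>. The eventual form serves both the criterion with
  \<open>\<delta>\<close> and the one with the lower limit.\<close>

lemma not_S_number_imp_not_eventually_linear:
  assumes tr: "\<not> algebraic \<zeta>" and S: "\<not> S_number \<zeta>" and \<delta>: "0 < \<delta>"
  shows "\<not> (\<forall>\<^sub>F n in sequentially. ereal (\<delta> * real n) \<le> w_hat_star n \<zeta>)"
proof
  assume "\<forall>\<^sub>F n in sequentially. ereal (\<delta> * real n) \<le> w_hat_star n \<zeta>"
  then obtain N where N: "\<And>n. n \<ge> N \<Longrightarrow> ereal (\<delta> * real n) \<le> w_hat_star n \<zeta>"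
    by (auto simp: eventually_sequentially)
  obtain M :: nat where M: "2 / \<delta> < real M" using reals_Archimedean2 by blast
  have "0 < 2 / \<delta>" using \<delta> by simp
  hence M0: "0 < real M" using M by linarith
  obtain m where m: "N \<le> m" "1 \<le> m" "w_hat_star (M * m) \<zeta> \<le> ereal (2 * real m)"
    using not_S_number_imp_w_hat_star_le[OF tr S] by blast
  have "m \<le> M * m" using M0 by simp
  hence "N \<le> M * m" using m(1) by linarith
  hence "ereal (\<delta> * real (M * m)) \<le> ereal (2 * real m)" using N m(3) by (meson order_trans)
  hence "(\<delta> * real M) * real m \<le> 2 * real m" by (simp add: mult.assoc)
  hence "\<delta> * real M \<le> 2" using m(2) by simp
  thus False using M \<delta> by (simp add: divide_less_eq mult.commute)
qed

lemma S_number_imp_w_hat_star_linear: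
  assumes tr: "\<not> algebraic \<zeta>" and S: "S_number \<zeta>"
  shows "\<exists>\<delta>>0. \<forall>n\<ge>1. w_hat_star n \<zeta> \<ge> ereal (\<delta> * real n)"
proof -
  obtain k :: nat where k: "limsup (\<lambda>n. w_exponent n \<zeta> / ereal (real n)) < ereal (real k)"
    using S less_PInf_Ex_of_nat unfolding S_number_def by auto
  obtain N where N: "\<And>n. n \<ge> N \<Longrightarrow> w_exponent n \<zeta> / ereal (real n) < ereal (real k)"
    using Limsup_lessD[OF k] by (auto simp: eventually_sequentially)
  define n0 where "n0 = max 1 N"
  \<comment> \<open>For degrees \<open>e\<close> below \<open>n0\<close>, monotonicity gives
    \<open>w_e <= w_n0 < k * n0 <= K * e\<close>.\<close>
  define K where "K = max 1 (k * n0)"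
  have lt: "w_exponent n \<zeta> < ereal (real (k * n))" if "n0 \<le> n" for n
  proof -
    have n: "N \<le> n" "0 < ereal (real n)" using that unfolding n0_def by auto
    have "w_exponent n \<zeta> < ereal (real n) * ereal (real k)"
      using N[OF n(1)] n(2) by (subst (asm) ereal_divide_less_pos) auto
    thus ?thesis by (simp add: mult.commute)
  qed
  have w: "w_exponent e \<zeta> < ereal (real (K * e))" if e: "1 \<le> e" for e
  proof (cases "n0 \<le> e")
    case True
    have "k * e \<le> K * e" unfolding K_def n0_def by (intro mult_le_mono1) (simp add: le_max_iff_disj)
    hence "ereal (real (k * e)) \<le> ereal (real (K * e))" by (simp only: ereal_less_eq of_nat_le_iff)
    thus ?thesis using lt[OF True] by order
  next
    case False
    have "w_exponent e \<zeta> \<le> w_exponent n0 \<zeta>" using False by (intro w_exponent_mono) simp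
    moreover have "k * n0 \<le> K * e" using e mult_le_mono[of "k * n0" K 1 e] unfolding K_def by simp
    hence "ereal (real (k * n0)) \<le> ereal (real (K * e))" by (simp only: ereal_less_eq of_nat_le_iff)
    ultimately show ?thesis using lt[OF order_refl] by order
  qed
  have K: "1 \<le> K" unfolding K_def by simp
  \<comment> \<open>The factor 2 pays for rounding \<open>n\<close> down to a multiple of
    \<open>K + 1\<close>: with \<open>m = n div (K + 1) >= 1\<close> one has
    \<open>n < (K + 1) * (m + 1) <= 2 * (K + 1) * m\<close>.\<close>
  define \<delta> where "\<delta> = 1 / (2 * real (K + 1))"
  have "ereal (\<delta> * real n) \<le> w_hat_star n \<zeta>" if n: "1 \<le> n" for n
  proof (cases "K + 1 \<le> n")
    case True
    define m where "m = n div (K + 1)"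
    have m: "1 \<le> m" unfolding m_def using True by (simp add: div_greater_zero_iff Suc_le_eq)
    have "n < (K + 1) * (m + 1)"
      unfolding m_def using dividend_less_times_div[of "K + 1" n] by simp
    also have "\<dots> \<le> (K + 1) * (2 * m)" using m by (intro mult_le_mono2) simp
    finally have "real n \<le> real ((K + 1) * (2 * m))" by (simp only: of_nat_le_iff less_imp_le)
    hence "\<delta> * real n \<le> real m" unfolding \<delta>_def by (simp add: divide_le_eq algebra_simps)
    hence "ereal (\<delta> * real n) \<le> ereal (real m)" by simp
    also have "\<dots> \<le> w_hat_star ((K + 1) * m) \<zeta>" using w by (intro w_hat_star_ge[OF tr K m])
    also have "\<dots> \<le> w_hat_star n \<zeta>" unfolding m_def by (intro w_hat_star_mono times_div_less_eq_dividend)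
    finally show ?thesis .
  next
    case False
    \<comment> \<open>Here \<open>\<delta> * n <= 1\<close>, and the exponent is at least 1 for
      every \<open>n >= 1\<close>.\<close>
    hence "real n \<le> 2 * real (K + 1)" by simp
    hence "\<delta> * real n \<le> 1" unfolding \<delta>_def by (simp add: divide_le_eq)
    hence "ereal (\<delta> * real n) \<le> 1" by (simp add: one_ereal_def)
    thus ?thesis using w_hat_star_ge_1[OF n, of \<zeta>] by order
  qed
  moreover have "0 < \<delta>" unfolding \<delta>_def by simp
  ultimately show ?thesis by blast
qed

lemma S_number_iff_w_hat_star_linear:
  assumes tr: "\<not> algebraic \<zeta>"
  shows "S_number \<zeta> \<longleftrightarrow> (\<exists>\<delta>>0. \<forall>n\<ge>1. w_hat_star n \<zeta> \<ge> ereal (\<delta> * real n))"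
proof
  assume "\<exists>\<delta>>0. \<forall>n\<ge>1. w_hat_star n \<zeta> \<ge> ereal (\<delta> * real n)"
  then obtain \<delta> where \<delta>: "0 < \<delta>" "\<And>n. n \<ge> 1 \<Longrightarrow> ereal (\<delta> * real n) \<le> w_hat_star n \<zeta>" by blast
  hence "\<forall>\<^sub>F n in sequentially. ereal (\<delta> * real n) \<le> w_hat_star n \<zeta>"
    unfolding eventually_sequentially by blast
  thus "S_number \<zeta>" using not_S_number_imp_not_eventually_linear[OF tr _ \<delta>(1)] by blast
qed (rule S_number_imp_w_hat_star_linear[OF tr])

text \<open>The quotients are nonnegative for \<open>n >= 1\<close>, so a nonzero lower limit is
  positive, and any positive \<open>\<delta>\<close> below it gives eventual linear growth.\<close>

lemma S_number_iff_liminf_nonzero: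
  assumes tr: "\<not> algebraic \<zeta>"
  shows "S_number \<zeta> \<longleftrightarrow> liminf (\<lambda>n. w_hat_star n \<zeta> / ereal (real n)) \<noteq> 0"
proof
  assume "S_number \<zeta>"
  then obtain \<delta> where \<delta>: "0 < \<delta>" "\<And>n. n \<ge> 1 \<Longrightarrow> ereal (\<delta> * real n) \<le> w_hat_star n \<zeta>"
    using S_number_imp_w_hat_star_linear[OF tr] by blast
  have "\<forall>\<^sub>F n in sequentially. ereal \<delta> \<le> w_hat_star n \<zeta> / ereal (real n)"
    using eventually_ge_at_top[of 1]
  proof eventually_elim
    case (elim n)
    thus ?case using \<delta>(2)[OF elim] by (subst ereal_le_divide_pos) (auto simp: mult.commute)
  qed
  hence "ereal \<delta> \<le> liminf (\<lambda>n. w_hat_star n \<zeta> / ereal (real n))" by (rule Liminf_bounded)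
  thus "liminf (\<lambda>n. w_hat_star n \<zeta> / ereal (real n)) \<noteq> 0" using \<delta>(1) by auto
next
  assume ne: "liminf (\<lambda>n. w_hat_star n \<zeta> / ereal (real n)) \<noteq> 0"
  have "\<forall>\<^sub>F n in sequentially. 0 \<le> w_hat_star n \<zeta> / ereal (real n)"
    using eventually_ge_at_top[of 1]
  proof eventually_elim
    case (elim n)
    have "0 \<le> w_hat_star n \<zeta>" by (rule order_trans[OF _ w_hat_star_ge_1[OF elim]]) simp
    thus ?case using elim by (subst ereal_le_divide_pos) auto
  qed
  hence "0 \<le> liminf (\<lambda>n. w_hat_star n \<zeta> / ereal (real n))" by (rule Liminf_bounded)
  hence "0 < liminf (\<lambda>n. w_hat_star n \<zeta> / ereal (real n))" using ne by simp
  then obtain \<delta> where \<delta>: "0 < ereal \<delta>" "ereal \<delta> < liminf (\<lambda>n. w_hat_star n \<zeta> / ereal (real n))"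
    using ereal_dense2 by blast
  have "\<forall>\<^sub>F n in sequentially. ereal (\<delta> * real n) \<le> w_hat_star n \<zeta>"
    using less_LiminfD[OF \<delta>(2)] eventually_ge_at_top[of 1]
  proof eventually_elim
    case (elim n)
    have "ereal (real n) * ereal \<delta> < w_hat_star n \<zeta>"
      using elim by (subst (asm) ereal_less_divide_pos) auto
    thus ?case by (simp add: mult.commute less_imp_le)
  qed
  thus "S_number \<zeta>" using not_S_number_imp_not_eventually_linear[OF tr, of \<delta>] \<delta>(1) by auto
qed

theorem theorem2p5:
  fixes \<zeta> :: real
  assumes "\<not> algebraic \<zeta>"
  shows "(U_number \<zeta> \<longleftrightarrow> (\<exists>L. (\<lambda>n. w_hat_star n \<zeta>) \<longlonglongrightarrow> L \<and> L < \<infinity>))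
    \<and> (\<forall>m. Um_number m \<zeta> \<longrightarrow>
         (\<forall>\<^sub>F n in sequentially. w_hat_star n \<zeta> \<in> {ereal (real m - 1)..ereal (real m)}))
    \<and> (T_number \<zeta> \<longleftrightarrow>
         (\<lambda>n. w_hat_star n \<zeta>) \<longlonglongrightarrow> \<infinity> \<and>
         liminf (\<lambda>n. w_hat_star n \<zeta> / ereal (real n)) = 0)
    \<and> (S_number \<zeta> \<longleftrightarrow>
         (\<exists>\<delta> > 0. \<forall>n\<ge>1. w_hat_star n \<zeta> \<ge> ereal (\<delta> * real n)))"
proof (intro conjI allI impI)
  show "T_number \<zeta> \<longleftrightarrow> (\<lambda>n. w_hat_star n \<zeta>) \<longlonglongrightarrow> \<infinity> \<and>
         liminf (\<lambda>n. w_hat_star n \<zeta> / ereal (real n)) = 0"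
  proof -
    \<comment> \<open>Finiteness of all \<open>w_n\<close> is the negation of the U-condition, and
      the infinite upper limit that of the S-condition.\<close>
    have "T_number \<zeta> \<longleftrightarrow> \<not> U_number \<zeta> \<and> \<not> S_number \<zeta>"
      unfolding T_number_def S_number_def U_number_iff_w_exponent_infinite by (auto simp: less_top)
    moreover have "\<not> U_number \<zeta> \<longleftrightarrow> (\<lambda>n. w_hat_star n \<zeta>) \<longlonglongrightarrow> \<infinity>"
      using U_number_iff_w_hat_star_limit_finite[OF assms]
        not_U_number_imp_w_hat_star_tendsto[OF assms] LIMSEQ_unique less_irrefl by metis
    ultimately show ?thesis using S_number_iff_liminf_nonzero[OF assms] by blast
  qed
qed (use assms U_number_iff_w_hat_star_limit_finite Um_number_imp_w_hat_star_bounds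
      S_number_iff_w_hat_star_linear in blast)+

end
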